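(* Consider problem (P) and Algorithm A described in the context, and suppose Algorithm A generates an infinite sequence $\{x^k\}$. Assume: (i) the functions $f_i$, $i\in\{0\}\cup I$, are all twice continuously differentiable on $\mathbb{R}^n$; (ii) for each $x\in\mathbb{R}^n$ the vectors $\{g_i(x):i\in I(x)\}$ are linearly independent; (iii) $\{x^k\}$ is bounded; (iv) there exist $a,b>0$ such that $a\|d\|^2\le d^TH_kd\le b\|d\|^2$ for all $d\in\mathbb{R}^n$ and all $k$; (v) $x^*$ is an accumulation point of $\{x^k\}$ and $(x^*,\mu^* )$ is a KKT pair of (P) satisfying the strong second-order sufficient condition: $d^T\nabla^2_{xx}L(x^*,\mu^* )d>0$ for all $d\in\mathbb{R}^n$, $d\ne0$, with $g_i(x^* )^Td=0$ for all $i\in I_*^+$, where $\nabla^2_{xx}L(x^*,\mu^* )=\nabla^2f_0(x^* )+\sum_{i\in I}\mu_i^*\nabla^2f_i(x^* )$ and $I_*^+=\{i\in I_1:\mu_i^*>0\}\cup I_2$; (vi) $\|(\nabla^2_{xx}L_c(x^*,\lambda^* )-H_k)d_0^k\|=o(\|d_0^k\|)$ as $k\to\infty$, where $\lambda_i^*=\mu_i^*$ for $i\in I_1$, $\lambda_i^*=\mu_i^*+c$ for $i\in I_2$, and $\nabla^2_{xx}L_c(x^*,\lambda^* )=\nabla^2F_c(x^* )+\sum_{i\in I}\lambda_i^*\nabla^2f_i(x^* )=\nabla^2_{xx}L(x^*,\mu^* )$. Then $\varphi(x^{k+1})=0$ after a finite number of iterations, i.e. $x^{k+1}\in\Omega^+:=\{x\in\mathbb{R}^n:f_i(x)\le0,\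 i\in I\}$ for all $k$ large enough.
   Context: **Problem and notation.** Let $I_1=\{1,\dots,m'\}$, $I_2=\{m'+1,\dots,m\}$, $I=I_1\cup I_2$, $f_i:\mathbb{R}^n\to\mathbb{R}$, $g_i=\nabla f_i$ for $i\in\{0\}\cup I$. Problem (P): minimize $f_0(x)$ subject to $f_i(x)\le 0$ $(i\in I_1)$, $f_i(x)=0$ $(i\in I_2)$. For $c>0$, $F_c(x)=f_0(x)-c\sum_{i\in I_2}f_i(x)$ ($F_c=f_0$ if $I_2=\emptyset$). A KKT pair $(x,\mu)$ of (P): $x$ feasible, $g_0(x)+\sum_{i\in I}\mu_ig_i(x)=0$, $\mu_i\ge0$ and $\mu_if_i(x)=0$ for $i\in I_1$. Put $\varphi(x)=\max\{0,f_i(x),i\in I\}$, $I^+(x)=\{i\in I:f_i(x)>0\}$, $I^-(x)=\{i\in I:f_i(x)\le0\}$; $\bar f_i(x)=f_i(x)$ for $i\in I^-(x)$ and $\bar f_i(x)=f_i(x)-\varphi(x)$ for $i\in I^+(x)$; $I_1(x)=\{i\in I_1:\bar f_i(x)=0\}$, $I(x)=I_1(x)\cup I_2$. Let $N(x)=(g_i(x),i\in I)$ ($n\times m$ matrix), $D(x)=\mathrm{diag}(D_i(x),i\in I)$ with $D_i(x)=|\bar f_i(x)|^p$ for $i\in I_1$ and $D_i(x)=0$ for $i\in I_2$, and $\pi(x)=-(N(x)^TN(x)+D(x))^{-1}N(x)^Tg_0(x)$. **Objects at iteration $k$** (given $x^k$, $c_k$, symmetric positive definite $H_k$). $d_0^k$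 is the unique solution of the QP: minimize $\nabla F_{c_k}(x^k)^Td+\frac12d^TH_kd$ subject to $\bar f_i(x^k)+g_i(x^k)^Td\le0$, $i\in I$. Let $N_k=N(x^k)$, $Q^k=\mathrm{diag}(Q^k_i,i\in I)$, $Q_i^k=|\bar f_i(x^k)|\,(|\bar f_i(x^k)+g_i(x^k)^Td_0^k|+\|d_0^k\|)$, $\Gamma_k=\begin{pmatrix}H_k&N_k\\ N_k^T&-Q^k\end{pmatrix}$, $\varpi=(1,\dots,1)^T\in\mathbb{R}^m$. Then $(d_1^k,h_1^k)$ and $(d_2^k,h_2^k)$ are the solutions of $$\Gamma_k\begin{pmatrix}d_1^k\\ h_1^k\end{pmatrix}=\begin{pmatrix}0\\ -(\|d_0^k\|+\varphi(x^k)^\sigma)\varpi\end{pmatrix},\quad \Gamma_k\begin{pmatrix}d_2^k\\ h_2^k\end{pmatrix}=\begin{pmatrix}0\\ -(\|d_0^k\|^\tau+\varphi(x^k)^\sigma)\varpi-\digamma(x^k+d_0^k)\end{pmatrix},$$ where $\digamma(x^k+d_0^k)=(f_i(x^k+d_0^k)-f_i(x^k)-g_i(x^k)^Td_0^k,\ i\in I)$. Let $\hat d^k=(1-\beta_k)d_0^k+\beta_kd_1^k$, where $\beta_k$ is the largest $\beta\in[0,1]$ with $\nabla F_{c_k}(x^k)^T((1-\beta)d_0^k+\beta d_1^k)\le\theta\nabla F_{c_k}(x^k)^Td_0^k+\varphi(x^k)^\theta$. **Algorithm A.** Parameters: $p,\epsilon,\gamma,\gamma_0>0$, $c_{-1}>0$,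 $\rho>1$, $0<\theta<\sigma$, $\sigma,\eta,\alpha,\hat\alpha\in(0,1)$, $\tau\in(2,3)$. Data: $x^0\in\mathbb{R}^n$, symmetric positive definite $H_0$; $k:=0$. Step 1. $s_k=\max\{|\pi_i(x^k)|:i\in I_2\}+\gamma_0$; $c_k=\max\{s_k,c_{k-1}+\gamma\}$ if $s_k>c_{k-1}$, and $c_k=c_{k-1}$ otherwise. Step 2. Compute $d_0^k$. If $(d_0^k,\varphi(x^k))=(0,0)$, stop. Step 3. Compute $d_2^k$, set $d^k=d_0^k+d_2^k$. Step 4. Let $t=1$. (a) If $F_{c_k}(x^k+td^k)\le F_{c_k}(x^k)+\alpha t\nabla F_{c_k}(x^k)^Td_0^k+\rho(1-\alpha)t\varphi(x^k)^\theta$, $f_i(x^k+td^k)\le\max\{0,\varphi(x^k)-\alpha t(\|d_0^k\|^\tau+\varphi(x^k)^\sigma)\}$ for all $i\in I$, and $|I^-(x^k+td^k)|\ge|I^-(x^k)|$, set $t_k=t$ and go to Step 7. (b) Otherwise $t:=t/2$; if $t<\epsilon$ go to Step 5, else repeat (a). Step 5. Compute $d_1^k$ and $\hat d^k$. Step 6. Let $t_k$ be the first $t\in\{1,\eta,\eta^2,\dots\}$ with $F_{c_k}(x^k+t\hat d^k)\le F_{c_k}(x^k)+\hat\alpha t\nabla F_{c_k}(x^k)^T\hat d^k+\rho(1-\hat\alpha)t\varphi(x^k)^\theta$, $f_i(x^k+t\hat d^k)\le\max\{0,\varphi(x^k)-\hat\alpha t\beta_k(\|d_0^k\|+\varphi(x^k)^\sigma)\}$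 for all $i\in I$, and $|I^-(x^k+t\hat d^k)|\ge|I^-(x^k)|$; set $d^k=\hat d^k$. Step 7. Choose (by some technique) a symmetric positive definite $H_{k+1}$, set $x^{k+1}=x^k+t_kd^k$, $k:=k+1$, go to Step 1. **Convention.** Under the stated assumptions the sequence $c_k$ is eventually constant; its eventual value is denoted $c$, and one takes $c_k=c$ for all $k$. *)

theory Defs
  imports "HOL-Analysis.Analysis" "HOL-Library.Landau_Symbols"
begin

section \<open>Calculus and linear algebra\<close>

definition gradient :: "(real^'n \<Rightarrow> real) \<Rightarrow> real^'n \<Rightarrow> real^'n" where
  "gradient u x = (THE D. GDERIV u x :> D)"

definition hessian :: "(real^'n \<Rightarrow> real) \<Rightarrow> real^'n \<Rightarrow> real^'n^'n" where
  "hessian u x = jacobian (gradient u) (at x)"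

definition twice_cont_diff :: "(real^'n \<Rightarrow> real) \<Rightarrow> bool" where
  "twice_cont_diff u \<longleftrightarrow>
     (\<forall>x. u differentiable (at x)) \<and> (\<forall>x. gradient u differentiable (at x)) \<and>
     continuous_on UNIV (hessian u)"

definition sym_pos_def :: "real^'n^'n \<Rightarrow> bool" where
  "sym_pos_def A \<longleftrightarrow> transpose A = A \<and> (\<forall>v. v \<noteq> 0 \<longrightarrow> v \<bullet> (A *v v) > 0)"

definition diag_mat :: "real^'m \<Rightarrow> real^'m^'m" where
  "diag_mat v = (\<chi> i j. if i = j then v $ i else 0)"

definition stack :: "real^'n \<Rightarrow> real^'m \<Rightarrow> real^('n + 'm)" where
  "stack u v = (\<chi> i. case i of Inl r \<Rightarrow> u $ r | Inr s \<Rightarrow> v $ s)"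

definition block_mat ::
  "real^'n^'n \<Rightarrow> real^'m^'n \<Rightarrow> real^'n^'m \<Rightarrow> real^'m^'m \<Rightarrow> real^('n + 'm)^('n + 'm)" where
  "block_mat A B C D = (\<chi> i j. case i of
       Inl r \<Rightarrow> (case j of Inl s \<Rightarrow> A $ r $ s | Inr s \<Rightarrow> B $ r $ s)
     | Inr r \<Rightarrow> (case j of Inl s \<Rightarrow> C $ r $ s | Inr s \<Rightarrow> D $ r $ s))"

definition accumulation_point :: "(nat \<Rightarrow> real^'n) \<Rightarrow> real^'n \<Rightarrow> bool" where
  "accumulation_point x l \<longleftrightarrow> (\<exists>r :: nat \<Rightarrow> nat. strict_mono r \<and> (x \<circ> r) \<longlonglongrightarrow> l)"

text \<open>Meaningful only for eventually constant sequences.\<close>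

definition eventual_value :: "(nat \<Rightarrow> real) \<Rightarrow> real" where
  "eventual_value u = (THE v. \<forall>\<^sub>F k in sequentially. u k = v)"


section \<open>The nonlinear program\<close>

text \<open>
  Minimize \<open>f0\<close> subject to \<open>f i x \<le> 0\<close> for \<open>i \<notin> I2\<close> and \<open>f i x = 0\<close> for \<open>i \<in> I2\<close>. The index set
  \<open>I = {1,\<dots>,m}\<close> is the finite type \<open>'m\<close>, so \<open>m \<ge> 1\<close>; either \<open>I2\<close> or its complement may be empty.
\<close>

locale nlp =
  fixes f0 :: "real^'n \<Rightarrow> real"
    and f :: "'m::finite \<Rightarrow> real^'n \<Rightarrow> real"
    and I2 :: "'m set"
begin

definition I1 :: "'m set" where
  "I1 = - I2"

definition g :: "'m \<Rightarrow> real^'n \<Rightarrow> real^'n" where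
  "g i = gradient (f i)"

definition F :: "real \<Rightarrow> real^'n \<Rightarrow> real" where
  "F c x = f0 x - c * (\<Sum>i\<in>I2. f i x)"

definition KKT_pair :: "real^'n \<Rightarrow> real^'m \<Rightarrow> bool" where
  "KKT_pair x \<mu> \<longleftrightarrow>
     (\<forall>i\<in>I1. f i x \<le> 0) \<and> (\<forall>i\<in>I2. f i x = 0) \<and>
     gradient f0 x + (\<Sum>i\<in>UNIV. \<mu> $ i *\<^sub>R g i x) = 0 \<and>
     (\<forall>i\<in>I1. \<mu> $ i \<ge> 0 \<and> \<mu> $ i * f i x = 0)"

definition hess_L :: "real^'n \<Rightarrow> real^'m \<Rightarrow> real^'n^'n" where
  "hess_L x \<mu> = hessian f0 x + (\<Sum>i\<in>UNIV. \<mu> $ i *\<^sub>R hessian (f i) x)"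

definition hess_Lc :: "real \<Rightarrow> real^'n \<Rightarrow> real^'m \<Rightarrow> real^'n^'n" where
  "hess_Lc c x l = hessian (F c) x + (\<Sum>i\<in>UNIV. l $ i *\<^sub>R hessian (f i) x)"

definition shifted_mult :: "real \<Rightarrow> real^'m \<Rightarrow> real^'m" where
  "shifted_mult c \<mu> = (\<chi> i. if i \<in> I2 then \<mu> $ i + c else \<mu> $ i)"

definition strong_SOSC :: "real^'n \<Rightarrow> real^'m \<Rightarrow> bool" where
  "strong_SOSC x \<mu> \<longleftrightarrow>
     (\<forall>d. d \<noteq> 0 \<and> (\<forall>i \<in> {i\<in>I1. \<mu> $ i > 0} \<union> I2. g i x \<bullet> d = 0)
        \<longrightarrow> d \<bullet> (hess_L x \<mu> *v d) > 0)"

definition phi :: "real^'n \<Rightarrow> real" where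
  "phi x = Max (insert 0 (range (\<lambda>i. f i x)))"

definition Iminus :: "real^'n \<Rightarrow> 'm set" where
  "Iminus x = {i. f i x \<le> 0}"

definition Omega_plus :: "(real^'n) set" where
  "Omega_plus = {x. \<forall>i. f i x \<le> 0}"

definition fbar :: "'m \<Rightarrow> real^'n \<Rightarrow> real" where
  "fbar i x = (if i \<in> Iminus x then f i x else f i x - phi x)"

definition active :: "real^'n \<Rightarrow> 'm set" where
  "active x = {i\<in>I1. fbar i x = 0} \<union> I2"

text \<open>Linear independence of the indexed family: repeated gradients count as dependent.\<close>

definition LICQ_at :: "real^'n \<Rightarrow> bool" where
  "LICQ_at x \<longleftrightarrow>
     inj_on (\<lambda>i. g i x) (active x) \<and> independent ((\<lambda>i. g i x) ` active x)"

definition Nmat :: "real^'n \<Rightarrow> real^'m^'n" where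
  "Nmat x = (\<chi> r i. g i x $ r)"

definition Dmat :: "real \<Rightarrow> real^'n \<Rightarrow> real^'m^'m" where
  "Dmat p x = diag_mat (\<chi> i. if i \<in> I2 then 0 else \<bar>fbar i x\<bar> powr p)"

definition pi_mult :: "real \<Rightarrow> real^'n \<Rightarrow> real^'m" where
  "pi_mult p x =
     - (matrix_inv (transpose (Nmat x) ** Nmat x + Dmat p x) *v (transpose (Nmat x) *v gradient f0 x))"

text \<open>
  Inserting \<open>0\<close> does not change a maximum of absolute values over a nonempty \<open>I2\<close>; for empty \<open>I2\<close>
  the penalty parameter is irrelevant since \<open>F c = f0\<close>.
\<close>

definition s_val :: "real \<Rightarrow> real \<Rightarrow> real^'n \<Rightarrow> real" where
  "s_val p \<gamma>0 x = Max (insert 0 ((\<lambda>i. \<bar>pi_mult p x $ i\<bar>) ` I2)) + \<gamma>0"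

definition QP_solution :: "real \<Rightarrow> real^'n^'n \<Rightarrow> real^'n \<Rightarrow> real^'n \<Rightarrow> bool" where
  "QP_solution c H x d0 \<longleftrightarrow>
     is_arg_min (\<lambda>d. gradient (F c) x \<bullet> d + (1/2) * (d \<bullet> (H *v d)))
       (\<lambda>d. \<forall>i. fbar i x + g i x \<bullet> d \<le> 0) d0"

definition Qmat :: "real^'n \<Rightarrow> real^'n \<Rightarrow> real^'m^'m" where
  "Qmat x d0 = diag_mat (\<chi> i. \<bar>fbar i x\<bar> * (\<bar>fbar i x + g i x \<bullet> d0\<bar> + norm d0))"

definition Gamma_mat :: "real^'n^'n \<Rightarrow> real^'n \<Rightarrow> real^'n \<Rightarrow> real^('n + 'm)^('n + 'm)" where
  "Gamma_mat H x d0 = block_mat H (Nmat x) (transpose (Nmat x)) (- Qmat x d0)"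

definition digamma_vec :: "real^'n \<Rightarrow> real^'n \<Rightarrow> real^'m" where
  "digamma_vec x d0 = (\<chi> i. f i (x + d0) - f i x - g i x \<bullet> d0)"

text \<open>
  Common form of the two line search tests: \<open>a\<close> is \<open>\<alpha>\<close> or \<open>\<alpha>'\<close>, \<open>slope\<close> the directional derivative,
  and \<open>r\<close> the factor of \<open>a * t\<close> in the bound on the constraint values.
\<close>

definition search_test ::
  "real \<Rightarrow> real \<Rightarrow> real \<Rightarrow> real \<Rightarrow> real^'n \<Rightarrow> real^'n \<Rightarrow> real \<Rightarrow> real \<Rightarrow> real \<Rightarrow> bool" where
  "search_test \<rho> \<theta> a c x d slope r t \<longleftrightarrow>
     F c (x + t *\<^sub>R d) \<le> F c x + a * t * slope + \<rho> * (1 - a) * t * phi x powr \<theta> \<and>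
     (\<forall>i. f i (x + t *\<^sub>R d) \<le> max 0 (phi x - a * t * r)) \<and>
     card (Iminus (x + t *\<^sub>R d)) \<ge> card (Iminus x)"

end


section \<open>Infinite runs of the algorithm\<close>

text \<open>
  \<open>c_init\<close> is the initial penalty parameter with index \<open>-1\<close>, and \<open>\<alpha>'\<close> is the second line search
  constant. The data \<open>d1\<close>, \<open>h1\<close>, \<open>\<beta>\<close> are only constrained at iterations that reach Step 5.
\<close>

locale algorithm_A_run = nlp f0 f I2
  for f0 :: "real^'n \<Rightarrow> real"
    and f :: "'m::finite \<Rightarrow> real^'n \<Rightarrow> real"
    and I2 :: "'m set" +
  fixes p \<epsilon> \<gamma> \<gamma>0 c_init \<rho> \<theta> \<sigma> \<eta> \<alpha> \<alpha>' \<tau> :: real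
    and x :: "nat \<Rightarrow> real^'n"
    and c :: "nat \<Rightarrow> real"
    and H :: "nat \<Rightarrow> real^'n^'n"
    and d0 d1 d2 d :: "nat \<Rightarrow> real^'n"
    and h1 h2 :: "nat \<Rightarrow> real^'m"
    and \<beta> t :: "nat \<Rightarrow> real"
  assumes positive_params: "p > 0" "\<epsilon> > 0" "\<gamma> > 0" "\<gamma>0 > 0" "c_init > 0"
    and rho: "\<rho> > 1"
    and theta: "0 < \<theta>" "\<theta> < \<sigma>"
    and unit_params: "\<sigma> \<in> {0<..<1}" "\<eta> \<in> {0<..<1}" "\<alpha> \<in> {0<..<1}" "\<alpha>' \<in> {0<..<1}"
    and tau: "\<tau> \<in> {2<..<3}"
    and H_spd: "\<And>k. sym_pos_def (H k)"
    and step1: "\<And>k. c k =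
      (let s = s_val p \<gamma>0 (x k); c_prev = (case k of 0 \<Rightarrow> c_init | Suc j \<Rightarrow> c j)
       in if s > c_prev then max s (c_prev + \<gamma>) else c_prev)"
    and step2: "\<And>k. QP_solution (c k) (H k) (x k) (d0 k)"
    and no_stop: "\<And>k. \<not> (d0 k = 0 \<and> phi (x k) = 0)"
    and step3: "\<And>k. Gamma_mat (H k) (x k) (d0 k) *v stack (d2 k) (h2 k) =
      stack 0 (- (norm (d0 k) powr \<tau> + phi (x k) powr \<sigma>) *\<^sub>R (\<chi> i. 1) - digamma_vec (x k) (d0 k))"
    and step456: "\<And>k.
      let G = gradient (F (c k)) (x k);
          test4 = search_test \<rho> \<theta> \<alpha> (c k) (x k) (d0 k + d2 k) (G \<bullet> d0 k)
                    (norm (d0 k) powr \<tau> + phi (x k) powr \<sigma>);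
          accept4 = (\<lambda>s. \<exists>j::nat. s = (1/2) ^ j \<and> (j = 0 \<or> s \<ge> \<epsilon>) \<and> test4 s \<and>
                       (\<forall>l<j. \<not> test4 ((1/2) ^ l)));
          dhat = (\<lambda>b. (1 - b) *\<^sub>R d0 k + b *\<^sub>R d1 k);
          test6 = search_test \<rho> \<theta> \<alpha>' (c k) (x k) (dhat (\<beta> k)) (G \<bullet> dhat (\<beta> k))
                    (\<beta> k * (norm (d0 k) + phi (x k) powr \<sigma>))
      in if \<exists>s. accept4 s
         then accept4 (t k) \<and> d k = d0 k + d2 k
         else Gamma_mat (H k) (x k) (d0 k) *v stack (d1 k) (h1 k) =
                stack 0 (- (norm (d0 k) + phi (x k) powr \<sigma>) *\<^sub>R (\<chi> i. 1)) \<and>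
              is_arg_max (\<lambda>b. b)
                (\<lambda>b. 0 \<le> b \<and> b \<le> 1 \<and> G \<bullet> dhat b \<le> \<theta> * (G \<bullet> d0 k) + phi (x k) powr \<theta>) (\<beta> k) \<and>
              (\<exists>j::nat. t k = \<eta> ^ j \<and> test6 (t k) \<and> (\<forall>l<j. \<not> test6 (\<eta> ^ l))) \<and>
              d k = dhat (\<beta> k)"
    and step7: "\<And>k. x (Suc k) = x k + t k *\<^sub>R d k"

end

theory Submission
  imports Defs
begin

text \<open>
  Both line searches force \<open>phi\<close> down, so \<open>phi (x k)\<close> decreases, and it tends to \<open>0\<close> because it
  vanishes at the KKT point \<open>xstar\<close>. An accepted step gives
  \<open>phi (x (Suc k)) \<le> max 0 (phi (x k) - \<kappa> * phi (x k) powr \<sigma>)\<close> with \<open>\<kappa> > 0\<close> independent of \<open>k\<close>, and since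
  \<open>\<sigma> < 1\<close> the right-hand side is \<open>0\<close> as soon as \<open>phi (x k)\<close> is small. For a step accepted in Step 4
  this holds as \<open>t k\<close> is bounded below by \<open>min 1 \<epsilon>\<close>. For Step 6, \<open>\<beta> k\<close> is maximal and \<open>\<theta> < \<sigma>\<close>, so that \<open>\<beta> k * (norm (d0 k) + phi (x k) powr \<sigma>)\<close>
  dominates \<open>phi (x k) powr \<sigma>\<close>; it also dominates the square of the norm of the search direction, which makes
  the second order terms harmless and bounds \<open>t k\<close> from below. The constants are uniform in \<open>k\<close> because
  linear independence of the active gradients, applied on a compact set containing the iterates, bounds the
  solutions of the linear systems as well as the penalty parameters.
\<close>

section \<open>Calculus\<close>

lemma gradient_eqI:
  assumes "GDERIV u x :> D"
  shows "gradient u x = D"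
  unfolding gradient_def
proof (rule the_equality[of _ D])
  fix E assume "GDERIV u x :> E"
  then have "(\<lambda>h. h \<bullet> E) = (\<lambda>h. h \<bullet> D)"
    using assms unfolding gderiv_def by (rule has_derivative_unique)
  then show "E = D"
    by (metis vector_eq_ldot)
qed (fact assms)

lemma GDERIV_gradient:
  assumes "u differentiable (at x)"
  shows "GDERIV u x :> gradient u x"
proof -
  obtain D where D: "(u has_derivative D) (at x)"
    using assms by (auto simp: differentiable_def)
  then interpret bounded_linear D
    by (rule has_derivative_bounded_linear)
  \<comment> \<open>The Riesz representative of the functional \<open>D\<close> is the value of its
    adjoint at \<open>1\<close>.\<close>
  have "D h = h \<bullet> adjoint D 1" for h
    using adjoint_works[OF linear_axioms, of h 1] by simp
  then have "GDERIV u x :> adjoint D 1"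
    using D unfolding gderiv_def by (metis (no_types, lifting) ext)
  then show ?thesis
    using gradient_eqI by metis
qed

lemma twice_cont_diff_GDERIV: "twice_cont_diff u \<Longrightarrow> GDERIV u x :> gradient u x"
  by (simp add: GDERIV_gradient twice_cont_diff_def)

lemma twice_cont_diff_continuous_on: "twice_cont_diff u \<Longrightarrow> continuous_on S u"
  by (meson continuous_at_imp_continuous_on differentiable_imp_continuous_within twice_cont_diff_def)

lemma twice_cont_diff_continuous_on_gradient: "twice_cont_diff u \<Longrightarrow> continuous_on S (gradient u)"
  by (meson continuous_at_imp_continuous_on differentiable_imp_continuous_within twice_cont_diff_def)

text \<open>On a ball the continuous Hessian is bounded, so the gradient is Lipschitz with some
  constant \<open>L\<close>; linearizing at \<open>y\<close> along the segment from \<open>y\<close>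
  to \<open>z\<close> then leaves a quadratic remainder.\<close>

lemma twice_cont_diff_taylor:
  assumes u: "twice_cont_diff u"
  obtains L where "L \<ge> 0" "\<And>y z. y \<in> cball 0 R \<Longrightarrow> z \<in> cball 0 R \<Longrightarrow>
    \<bar>u z - u y - gradient u y \<bullet> (z - y)\<bar> \<le> L * (norm (z - y))\<^sup>2"
proof -
  let ?S = "cball 0 R :: (real^'a) set"
  have "compact (hessian u ` ?S)"
    using u by (intro compact_continuous_image)
      (auto simp: twice_cont_diff_def intro: continuous_on_subset)
  then obtain M where M: "\<And>y. y \<in> ?S \<Longrightarrow> norm (hessian u y) \<le> M"
    by (meson bounded_iff compact_imp_bounded image_eqI)
  \<comment> \<open>The operator norm of a matrix is at most the number of its entries times a bound
    for their absolute values.\<close>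
  define L where "L = real CARD('a) * real CARD('a) * \<bar>M\<bar>"
  have L0: "L \<ge> 0" by (simp add: L_def)
  have onorm_hess: "onorm ((*v) (hessian u y)) \<le> L" if "y \<in> ?S" for y
    unfolding L_def
  proof (rule onorm_le_matrix_component)
    fix i j
    have "\<bar>hessian u y $ i $ j\<bar> \<le> norm (hessian u y)"
      using component_le_norm_cart[of "hessian u y $ i" j] Finite_Cartesian_Product.norm_nth_le[of "hessian u y" i]
      by linarith
    with M[OF that] show "\<bar>hessian u y $ i $ j\<bar> \<le> \<bar>M\<bar>" by linarith
  qed
  have dg: "(gradient u has_derivative ((*v) (hessian u y))) (at y within S)" for y S
    using u jacobian_works[of "gradient u" "at y"]
    by (simp add: twice_cont_diff_def hessian_def has_derivative_at_withinI)
  have lip: "norm (gradient u z - gradient u y) \<le> L * norm (z - y)"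
    if "y \<in> ?S" "z \<in> ?S" for y z
    by (rule differentiable_bound[OF convex_cball dg onorm_hess that(2) that(1)])
  have "\<bar>u z - u y - gradient u y \<bullet> (z - y)\<bar> \<le> L * (norm (z - y))\<^sup>2"
    if yz: "y \<in> ?S" "z \<in> ?S" for y z
  proof -
    let ?D = "\<lambda>w h. h \<bullet> gradient u w"
    \<comment> \<open>The mean value inequality for \<open>u\<close> minus its linearization at
      \<open>y\<close>: on the segment the derivative deviates from the one at \<open>y\<close> by
      at most \<open>L * norm (z - y)\<close>.\<close>
    have "norm (u z - u y - ?D y (z - y)) \<le> norm (z - y) * (L * norm (z - y))"
    proof (rule differentiable_bound_linearization[where S = "closed_segment y z" and f' = ?D and ?x0.0 = y])
      fix t :: real assume "t \<in> {0..1}"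
      then show "y + t *\<^sub>R (z - y) \<in> closed_segment y z"
        unfolding closed_segment_def by (auto intro!: exI[of _ t] simp: algebra_simps)
    next
      fix w assume w: "w \<in> closed_segment y z"
      show "(u has_derivative ?D w) (at w within closed_segment y z)"
        using twice_cont_diff_GDERIV[OF u, of w]
        by (simp add: gderiv_def has_derivative_at_withinI)
      have wS: "w \<in> ?S"
        using w yz closed_segment_subset[OF yz convex_cball] by blast
      have "norm (gradient u w - gradient u y) \<le> L * norm (w - y)"
        using lip[OF yz(1) wS] .
      also have "\<dots> \<le> L * norm (z - y)"
        using segment_bound(1)[OF w] L0 by (intro mult_left_mono) auto
      finally have le: "norm (gradient u w - gradient u y) \<le> L * norm (z - y)" .
      show "onorm (?D w - ?D y) \<le> L * norm (z - y)"
      proof (rule onorm_le)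
        fix h
        have "norm ((?D w - ?D y) h) \<le> norm h * norm (gradient u w - gradient u y)"
          using Cauchy_Schwarz_ineq2[of h "gradient u w - gradient u y"]
          by (simp add: inner_diff_right)
        also have "\<dots> \<le> norm h * (L * norm (z - y))"
          by (intro mult_left_mono le) auto
        finally show "norm ((?D w - ?D y) h) \<le> L * norm (z - y) * norm h"
          by (simp add: mult_ac)
      qed
    qed auto
    then show ?thesis
      by (simp add: inner_commute power2_eq_square mult_ac)
  qed
  with L0 that show ?thesis by blast
qed


section \<open>Linear algebra\<close>

lemma sum_UNIV_Plus:
  fixes h :: "'a::finite + 'b::finite \<Rightarrow> 'c::comm_monoid_add"
  shows "sum h UNIV = (\<Sum>i\<in>UNIV. h (Inl i)) + (\<Sum>i\<in>UNIV. h (Inr i))"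
  unfolding UNIV_Plus_UNIV[symmetric] by (subst sum.Plus) (auto simp: o_def)

lemma block_mat_stack:
  "block_mat A B C D *v stack u v = stack (A *v u + B *v v) (C *v u + D *v v)"
  by (vector block_mat_def stack_def matrix_vector_mult_def sum_UNIV_Plus)
    (auto split: sum.split)

lemma stack_eq_iff: "stack u v = stack u' v' \<longleftrightarrow> u = u' \<and> v = v'"
proof
  assume eq: "stack u v = stack u' v'"
  have "u $ i = u' $ i" for i
    using arg_cong[OF eq, of "\<lambda>w. w $ Inl i"] by (simp add: stack_def)
  moreover have "v $ i = v' $ i" for i
    using arg_cong[OF eq, of "\<lambda>w. w $ Inr i"] by (simp add: stack_def)
  ultimately show "u = u' \<and> v = v'" by (simp add: vec_eq_iff)
qed simp

lemma diag_mat_mult: "diag_mat w *v u = (\<chi> i. w $ i * u $ i)"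
  by (simp add: vec_eq_iff diag_mat_def matrix_vector_mult_def if_distrib[of "\<lambda>z. z * _"] cong: if_cong)

lemma matrix_vector_mult_minus_right: "(A::real^'n^'m) *v (- y) = - (A *v y)"
  by (simp add: vec_eq_iff matrix_vector_mult_def sum_negf)

lemma inner_transpose_mult: "(transpose A *v y) \<bullet> z = (y::real^_) \<bullet> (A *v z)"
  by (metis dot_lmul_matrix vector_transpose_matrix transpose_transpose)

lemma matrix_inv_mult_self:
  fixes A :: "real^'n^'n"
  assumes "\<And>v. A *v v = 0 \<Longrightarrow> v = 0"
  shows "A *v (matrix_inv A *v w) = w"
proof -
  have "invertible A"
    using assms matrix_left_invertible_ker[of A] by (auto simp: invertible_left_inverse)
  then have "A ** matrix_inv A = mat 1"
    unfolding matrix_inv_def invertible_def by (rule someI2_ex) blast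
  then show ?thesis
    by (simp add: matrix_vector_mul_assoc)
qed

text \<open>This is the operator inequality \<open>A\<^sup>2 \<le> b * A\<close> for
  \<open>0 \<le> A \<le> b\<close>. It follows without spectral theory by evaluating the nonnegative
  form at \<open>v - (1 / b) *\<^sub>R (A *v v)\<close>.\<close>

lemma norm_sq_mult_le:
  fixes A :: "real^'n^'n"
  assumes sym: "transpose A = A" and nonneg: "\<And>v. 0 \<le> v \<bullet> (A *v v)"
    and b: "b > 0" "\<And>v. v \<bullet> (A *v v) \<le> b * (norm v)\<^sup>2"
  shows "(norm (A *v v))\<^sup>2 \<le> b * (v \<bullet> (A *v v))"
proof -
  define w where "w = A *v v"
  let ?z = "v - (1 / b) *\<^sub>R w"
  have "v \<bullet> (A *v w) = w \<bullet> w"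
    using inner_transpose_mult[of A v w] by (simp add: sym w_def)
  moreover have "norm w * norm w = w \<bullet> w"
    by (metis dot_square_norm power2_eq_square)
  ultimately have "?z \<bullet> (A *v ?z) = v \<bullet> w - 2 / b * (norm w)\<^sup>2 + (1 / b)\<^sup>2 * (w \<bullet> (A *v w))"
    by (simp add: matrix_vector_mult_diff_distrib matrix_vector_mult_scaleR w_def[symmetric]
        inner_diff_left inner_diff_right power2_eq_square
        inner_commute algebra_simps)
  also have "\<dots> \<le> v \<bullet> w - 2 / b * (norm w)\<^sup>2 + (1 / b)\<^sup>2 * (b * (norm w)\<^sup>2)"
    using b by (intro add_left_mono mult_left_mono) auto
  also have "\<dots> = v \<bullet> w - (norm w)\<^sup>2 / b"
    using b(1) by (simp add: power2_eq_square)
  finally have "(norm w)\<^sup>2 / b \<le> v \<bullet> w"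
    using nonneg[of ?z] by linarith
  then show ?thesis
    using b(1) by (simp add: w_def field_simps)
qed


section \<open>Uniform estimates on compact sets\<close>

context nlp
begin

section \<open>Properties of \<open>phi\<close>, \<open>fbar\<close> and the matrices of the
  method\<close>

lemma f_le_phi: "f i y \<le> phi y"
  unfolding phi_def by (intro Max_ge) auto

lemma phi_nonneg: "0 \<le> phi y"
  unfolding phi_def by (intro Max_ge) auto

lemma phi_le_iff: "phi y \<le> e \<longleftrightarrow> 0 \<le> e \<and> (\<forall>i. f i y \<le> e)"
  unfolding phi_def by (subst Max_le_iff) auto

lemma phi_eq_0_iff: "phi y = 0 \<longleftrightarrow> y \<in> Omega_plus"
  using phi_le_iff[of y 0] phi_nonneg[of y] by (auto simp: Omega_plus_def)

lemma fbar_nonpos: "fbar i y \<le> 0"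
  using f_le_phi[of i y] by (simp add: fbar_def Iminus_def)

lemma Nmat_mult: "Nmat y *v u = (\<Sum>i\<in>UNIV. u $ i *\<^sub>R g i y)"
  by (simp add: vec_eq_iff Nmat_def matrix_vector_mult_def mult.commute)

lemma transpose_Nmat_mult: "transpose (Nmat y) *v v = (\<chi> i. g i y \<bullet> v)"
  by (simp add: vec_eq_iff Nmat_def matrix_vector_mult_def transpose_def inner_vec_def)

lemma Gamma_solution_eqs:
  assumes "Gamma_mat H y e *v stack v h = stack 0 r"
  shows "H *v v = - (Nmat y *v h)" "transpose (Nmat y) *v v - Qmat y e *v h = r"
  using assms unfolding Gamma_mat_def block_mat_stack stack_eq_iff
  by (auto simp: add_eq_0_iff2 matrix_vector_mult_diff_rdistrib[of 0, simplified])

lemma inner_Dmat: "u \<bullet> (Dmat p y *v u) = (\<Sum>i\<in>I1. \<bar>fbar i y\<bar> powr p * (u $ i)\<^sup>2)"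
proof -
  have "u \<bullet> (Dmat p y *v u) = (\<Sum>i\<in>UNIV. if i \<in> I1 then \<bar>fbar i y\<bar> powr p * (u $ i)\<^sup>2 else 0)"
    by (auto simp: Dmat_def diag_mat_mult inner_vec_def I1_def power2_eq_square intro!: sum.cong)
  then show ?thesis
    by (simp add: sum.If_cases)
qed

text \<open>Injectivity of the family lets coefficients indexed by constraints be moved to the set
  of gradients, where \<open>independent\<close> applies.\<close>

lemma LICQ_at_D:
  assumes "LICQ_at y" "(\<Sum>i\<in>active y. v i *\<^sub>R g i y) = 0" "i \<in> active y"
  shows "v i = 0"
proof -
  have inj: "inj_on (\<lambda>i. g i y) (active y)" and ind: "independent ((\<lambda>i. g i y) ` active y)"
    using assms(1) by (auto simp: LICQ_at_def)
  let ?w = "\<lambda>z. v (the_inv_into (active y) (\<lambda>i. g i y) z)"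
  have "(\<Sum>z\<in>(\<lambda>i. g i y) ` active y. ?w z *\<^sub>R z) = 0"
    using assms(2) by (simp add: sum.reindex[OF inj] the_inv_into_f_f[OF inj])
  from independentD[OF ind _ subset_refl this, of "g i y"] have "?w (g i y) = 0"
    using assms(3) by auto
  then show ?thesis
    by (simp add: the_inv_into_f_f[OF inj] assms(3))
qed

text \<open>Inactivity means \<open>f i y < 0\<close> or \<open>0 < f i y < phi y\<close>. Both are
  strict and persist nearby: in the first case \<open>fbar i\<close> agrees with \<open>f i\<close>
  near \<open>y\<close>, in the second some \<open>f j\<close> exceeds \<open>f i\<close>, and
  \<open>fbar i z \<le> f i z - f j z\<close>.\<close>

lemma inactive_fbar_bound:
  assumes cont: "\<And>i. continuous_on UNIV (f i)" and i: "i \<notin> active y"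
  obtains q where "q > 0" "\<forall>\<^sub>F z in nhds y. fbar i z \<le> - q"
proof -
  have lim: "(f j \<longlongrightarrow> f j y) (nhds y)" for j
    using cont[of j] by (simp add: continuous_on_eq_continuous_within tendsto_nhds_iff continuous_at)
  have ne: "fbar i y \<noteq> 0"
    using i by (auto simp: active_def I1_def)
  consider "f i y < 0" | "0 < f i y" "f i y < phi y"
    using ne fbar_nonpos[of i y] f_le_phi[of i y] by (auto simp: fbar_def Iminus_def split: if_splits)
  then show ?thesis
  proof cases
    case 1
    then have "\<forall>\<^sub>F z in nhds y. f i z < f i y / 2"
      by (intro order_tendstoD(2)[OF lim]) auto
    then have "\<forall>\<^sub>F z in nhds y. fbar i z \<le> - (- f i y / 2)"
      by eventually_elim (use 1 in \<open>auto simp: fbar_def Iminus_def\<close>)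
    with 1 show ?thesis by (intro that[of "- f i y / 2"]) auto
  next
    case 2
    then obtain j where j: "f i y < f j y"
      using phi_le_iff[of y "f i y"] by (auto simp: not_le)
    have "((\<lambda>z. f j z - f i z) \<longlongrightarrow> f j y - f i y) (nhds y)"
      by (intro tendsto_intros lim)
    then have "\<forall>\<^sub>F z in nhds y. f j z - f i z > (f j y - f i y) / 2"
      by (rule order_tendstoD(1)) (use j in \<open>simp add: field_simps\<close>)
    moreover have "\<forall>\<^sub>F z in nhds y. f i z > 0"
      by (intro order_tendstoD(1)[OF lim] 2)
    ultimately have "\<forall>\<^sub>F z in nhds y. fbar i z \<le> - ((f j y - f i y) / 2)"
    proof eventually_elim
      case (elim z)
      then show ?case using f_le_phi[of j z] by (simp add: fbar_def Iminus_def field_simps)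
    qed
    with j show ?thesis by (intro that[of "(f j y - f i y) / 2"]) auto
  qed
qed

end

section \<open>Smooth problems with independent active gradients\<close>

locale regular_nlp = nlp f0 f I2
  for f0 :: "real^'n \<Rightarrow> real" and f :: "'m::finite \<Rightarrow> real^'n \<Rightarrow> real" and I2 :: "'m set" +
  assumes smooth0: "twice_cont_diff f0"
    and smooth: "\<And>i. twice_cont_diff (f i)"
    and LICQ: "\<And>y. LICQ_at y"
begin

lemma gradient_F: "gradient (F c) y = gradient f0 y - c *\<^sub>R (\<Sum>i\<in>I2. g i y)"
proof (rule gradient_eqI)
  have "((\<lambda>z. f0 z - c * (\<Sum>i\<in>I2. f i z)) has_derivative
      (\<lambda>h. h \<bullet> gradient f0 y - c * (\<Sum>i\<in>I2. h \<bullet> g i y))) (at y)"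
    using twice_cont_diff_GDERIV[OF smooth0] twice_cont_diff_GDERIV[OF smooth]
    unfolding gderiv_def g_def by (intro has_derivative_diff has_derivative_mult_right has_derivative_sum)
  then show "GDERIV (F c) y :> gradient f0 y - c *\<^sub>R (\<Sum>i\<in>I2. g i y)"
    by (simp add: gderiv_def F_def[abs_def] inner_diff_right inner_sum_right)
qed

lemma continuous_on_f: "continuous_on S (f i)"
  by (rule twice_cont_diff_continuous_on[OF smooth])

lemma continuous_on_g: "continuous_on S (g i)"
  unfolding g_def by (rule twice_cont_diff_continuous_on_gradient[OF smooth])

text \<open>
  Although \<open>fbar\<close> is discontinuous where some \<open>f i\<close> vanishes while \<open>phi\<close> is positive, a limit of
  points at which \<open>fbar i\<close> tends to \<open>0\<close> still has \<open>i\<close> in its active set, so that compactness applies.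
\<close>

lemma coercive_on_compact:
  assumes K: "compact K" and p: "p > 0"
  obtains \<kappa> where "\<kappa> > 0" "\<And>y u. y \<in> K \<Longrightarrow>
    \<kappa> * (norm u)\<^sup>2 \<le> (norm (Nmat y *v u))\<^sup>2 + (\<Sum>i\<in>I1. \<bar>fbar i y\<bar> powr p * (u $ i)\<^sup>2)"
proof -
  define E where "E y u = (norm (Nmat y *v u))\<^sup>2 + (\<Sum>i\<in>I1. \<bar>fbar i y\<bar> powr p * (u $ i)\<^sup>2)" for y u
  have "\<exists>\<kappa>>0. \<forall>y\<in>K. \<forall>u\<in>sphere 0 1. \<kappa> \<le> E y u"
  proof (rule ccontr)
    \<comment> \<open>Otherwise there are points of \<open>K\<close> and unit vectors with
      \<open>E\<close> tending to \<open>0\<close>; a limit pair along a subsequence will contradict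
      linear independence.\<close>
    assume "\<not> ?thesis"
    then have "\<exists>y\<in>K. \<exists>u\<in>sphere 0 1. E y u < 1 / Suc n" for n
      by (metis divide_pos_pos of_nat_0_less_iff zero_less_Suc zero_less_one not_le)
    then obtain Y U where Y: "\<And>n. Y n \<in> K" and U: "\<And>n. U n \<in> sphere 0 1"
      and small: "\<And>n. E (Y n) (U n) < 1 / Suc n"
      by metis
    have "compact (K \<times> (sphere 0 1 :: (real^'m) set))"
      using K by (intro compact_Times) auto
    then obtain l r where l: "l \<in> K \<times> (sphere 0 1 :: (real^'m) set)" and r: "strict_mono r"
      and lim: "((\<lambda>n. (Y n, U n)) \<circ> r) \<longlonglongrightarrow> l"
      using Y U by (metis (no_types, lifting) SigmaI compact_def)
    obtain y u where yu: "l = (y, u)" by force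
    have Ylim: "(\<lambda>n. Y (r n)) \<longlonglongrightarrow> y" and Ulim: "(\<lambda>n. U (r n)) \<longlonglongrightarrow> u"
      using tendsto_fst[OF lim] tendsto_snd[OF lim] by (auto simp: yu o_def)
    have Einv: "(\<lambda>n. 1 / real (Suc (r n))) \<longlonglongrightarrow> 0"
      using LIMSEQ_subseq_LIMSEQ[OF LIMSEQ_Suc[OF lim_1_over_n] r] by (simp add: o_def)
    have E_nonneg: "0 \<le> E (Y (r n)) (U (r n))" for n
      by (simp add: E_def sum_nonneg)
    have Elim: "(\<lambda>n. E (Y (r n)) (U (r n))) \<longlonglongrightarrow> 0"
      by (rule tendsto_sandwich[OF always_eventually always_eventually tendsto_const Einv];
          intro allI E_nonneg less_imp_le[OF small])
    have dominated: "X \<longlonglongrightarrow> 0" if "\<And>n. 0 \<le> X n" "\<And>n. X n \<le> E (Y (r n)) (U (r n))" for X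
      by (rule tendsto_sandwich[OF always_eventually always_eventually tendsto_const Elim];
          intro allI that)
    have "(\<lambda>n. (norm (Nmat (Y (r n)) *v U (r n)))\<^sup>2) \<longlonglongrightarrow> 0"
      by (rule dominated) (auto simp: E_def sum_nonneg)
    moreover have "(\<lambda>n. (norm (Nmat (Y (r n)) *v U (r n)))\<^sup>2) \<longlonglongrightarrow> (norm (Nmat y *v u))\<^sup>2"
      unfolding Nmat_mult
      by (intro tendsto_intros Ulim continuous_on_tendsto_compose[OF continuous_on_g[of UNIV] Ylim]) auto
    ultimately have Nu: "Nmat y *v u = 0"
      using LIMSEQ_unique by fastforce
    \<comment> \<open>Near \<open>y\<close> the weight of an inactive \<open>i\<close> stays above
      \<open>q powr p\<close>, so the vanishing of \<open>E\<close> forces this coordinate of the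
      limit to vanish.\<close>
    have inactive: "u $ i = 0" if i: "i \<notin> active y" for i
    proof -
      obtain q where q: "q > 0" "\<forall>\<^sub>F z in nhds y. fbar i z \<le> - q"
        using inactive_fbar_bound[OF continuous_on_f i] by blast
      have i1: "i \<in> I1" using i by (auto simp: active_def I1_def)
      have "\<forall>\<^sub>F n in sequentially. fbar i (Y (r n)) \<le> - q"
        using filterlim_iff[THEN iffD1, OF Ylim] q(2) by blast
      then have "\<forall>\<^sub>F n in sequentially. q powr p * (U (r n) $ i)\<^sup>2 \<le> E (Y (r n)) (U (r n))"
      proof eventually_elim
        case (elim n)
        have "q powr p * (U (r n) $ i)\<^sup>2 \<le> \<bar>fbar i (Y (r n))\<bar> powr p * (U (r n) $ i)\<^sup>2"
          using elim q(1) p by (intro mult_right_mono powr_mono2) auto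
        also have "\<dots> \<le> (\<Sum>i\<in>I1. \<bar>fbar i (Y (r n))\<bar> powr p * (U (r n) $ i)\<^sup>2)"
          by (rule member_le_sum[OF i1]) auto
        finally show ?case
          unfolding E_def by (simp add: add_increasing)
      qed
      then have "(\<lambda>n. q powr p * (U (r n) $ i)\<^sup>2) \<longlonglongrightarrow> 0"
        by (intro tendsto_sandwich[OF _ _ tendsto_const Elim]) auto
      moreover have "(\<lambda>n. q powr p * (U (r n) $ i)\<^sup>2) \<longlonglongrightarrow> q powr p * (u $ i)\<^sup>2"
        by (intro tendsto_intros Ulim)
      ultimately have "q powr p * (u $ i)\<^sup>2 = 0"
        using LIMSEQ_unique by blast
      with q(1) show ?thesis by simp
    qed
    \<comment> \<open>Only active coordinates remain in the relation \<open>Nmat y *v u = 0\<close>,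
      so independence gives \<open>u = 0\<close>, although \<open>u\<close> has norm
      \<open>1\<close>.\<close>
    have "(\<Sum>i\<in>active y. u $ i *\<^sub>R g i y) = (\<Sum>i\<in>UNIV. u $ i *\<^sub>R g i y)"
      by (rule sum.mono_neutral_left) (auto simp: inactive)
    then have "u $ i = 0" for i
      using LICQ_at_D[OF LICQ, where v = "\<lambda>i. u $ i"] inactive[of i] Nu by (auto simp: Nmat_mult)
    then have "u = 0" by (simp add: vec_eq_iff)
    then show False using l by (simp add: yu)
  qed
  then obtain \<kappa> where \<kappa>: "\<kappa> > 0" "\<And>y u. y \<in> K \<Longrightarrow> norm u = 1 \<Longrightarrow> \<kappa> \<le> E y u"
    by (auto simp: dist_norm)
  have "\<kappa> * (norm u)\<^sup>2 \<le> E y u" if "y \<in> K" for y u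
  proof (cases "u = 0")
    case True
    then show ?thesis by (simp add: E_def sum_nonneg)
  next
    case False
    \<comment> \<open>\<open>E y\<close> is homogeneous of degree two, which carries the bound from
      the unit sphere to all \<open>u\<close>.\<close>
    have scale: "E y (s *\<^sub>R u) = s\<^sup>2 * E y u" for s
      by (simp add: E_def matrix_vector_mult_scaleR power_mult_distrib sum_distrib_left
          distrib_left mult.left_commute)
    have "\<kappa> \<le> (1 / norm u)\<^sup>2 * E y u"
      using \<kappa>(2)[OF that, of "(1 / norm u) *\<^sub>R u"] False unfolding scale by simp
    then show ?thesis
      using False by (simp add: power_divide field_simps)
  qed
  with \<kappa>(1) show ?thesis
    using that unfolding E_def by blast
qed

section \<open>Uniform bounds for gradients, penalty parameters and linear systems\<close>

lemma gradients_bounded_on_compact: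
  assumes "compact K"
  shows "\<exists>M\<ge>1. \<forall>y\<in>K. norm (gradient f0 y) \<le> M \<and> (\<forall>i. norm (g i y) \<le> M)"
proof -
  have "compact (gradient f0 ` K)" "\<And>i. compact (g i ` K)"
    using assms by (auto intro!: compact_continuous_image continuous_on_g
        twice_cont_diff_continuous_on_gradient[OF smooth0])
  then have "bounded (gradient f0 ` K \<union> (\<Union>i. g i ` K))"
    by (auto intro!: bounded_UN compact_imp_bounded)
  then obtain M where M: "\<forall>v \<in> gradient f0 ` K \<union> (\<Union>i. g i ` K). norm v \<le> M"
    unfolding bounded_iff by (elim exE)
  then show ?thesis
    \<comment> \<open>A bound of at least \<open>1\<close> can also be inserted as a factor in front
      of nonnegative terms later on.\<close>
    by (intro exI[of _ "max 1 M"]) (auto simp: le_max_iff_disj)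
qed

text \<open>Coercivity makes the matrix \<open>A\<close> in \<open>pi_mult\<close> invertible.
  Testing its defining equation with \<open>pi_mult p y\<close> itself gives an energy identity that
  bounds first \<open>Nmat y *v pi_mult p y\<close> by \<open>M\<close>, then
  \<open>pi_mult p y\<close> through the coercivity constant.\<close>

lemma s_val_bounded_on_compact:
  assumes K: "compact K" and p: "p > 0"
  shows "\<exists>S. \<forall>y\<in>K. s_val p \<gamma>0 y \<le> S"
proof -
  obtain \<kappa> where \<kappa>: "\<kappa> > 0" "\<And>y u. y \<in> K \<Longrightarrow>
    \<kappa> * (norm u)\<^sup>2 \<le> (norm (Nmat y *v u))\<^sup>2 + (\<Sum>i\<in>I1. \<bar>fbar i y\<bar> powr p * (u $ i)\<^sup>2)"
    using coercive_on_compact[OF K p] by blast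
  obtain M where M: "M \<ge> 1" "\<And>y. y \<in> K \<Longrightarrow> norm (gradient f0 y) \<le> M"
    using gradients_bounded_on_compact[OF K] by blast
  have pi: "norm (pi_mult p y) \<le> sqrt (M\<^sup>2 / \<kappa>)" if y: "y \<in> K" for y
  proof -
    define A where "A = transpose (Nmat y) ** Nmat y + Dmat p y"
    have inner_A: "u \<bullet> (A *v u) = (norm (Nmat y *v u))\<^sup>2 + (\<Sum>i\<in>I1. \<bar>fbar i y\<bar> powr p * (u $ i)\<^sup>2)" for u
    proof -
      have "u \<bullet> (transpose (Nmat y) *v (Nmat y *v u)) = (norm (Nmat y *v u))\<^sup>2"
        unfolding inner_commute[of u] inner_transpose_mult power2_norm_eq_inner ..
      then show ?thesis
        by (simp add: A_def matrix_vector_mult_add_rdistrib inner_add_right inner_Dmat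
            flip: matrix_vector_mul_assoc)
    qed
    have "u = 0" if "A *v u = 0" for u
    proof -
      have "\<kappa> * (norm u)\<^sup>2 \<le> 0"
        using \<kappa>(2)[OF y, of u] that by (simp flip: inner_A)
      then show ?thesis using \<kappa>(1) by (simp add: mult_le_0_iff)
    qed
    then have "A *v (matrix_inv A *v w) = w" for w
      by (rule matrix_inv_mult_self)
    then have "A *v pi_mult p y = - (transpose (Nmat y) *v gradient f0 y)"
      by (simp only: pi_mult_def A_def[symmetric] matrix_vector_mult_minus_right)
    then have E: "pi_mult p y \<bullet> (A *v pi_mult p y) = - ((Nmat y *v pi_mult p y) \<bullet> gradient f0 y)"
      using inner_transpose_mult[of "Nmat y" "gradient f0 y" "pi_mult p y"]
      by (simp only: inner_commute[of "pi_mult p y"] inner_commute[of "gradient f0 y"] inner_minus_left)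
    let ?n = "norm (Nmat y *v pi_mult p y)"
    have le: "pi_mult p y \<bullet> (A *v pi_mult p y) \<le> ?n * M"
      using norm_cauchy_schwarz[of "- (Nmat y *v pi_mult p y)" "gradient f0 y"]
        mult_left_mono[OF M(2)[OF y], of ?n] by (simp add: E)
    moreover have "?n\<^sup>2 \<le> pi_mult p y \<bullet> (A *v pi_mult p y)"
      by (simp add: inner_A sum_nonneg)
    ultimately have "?n * ?n \<le> ?n * M"
      by (simp add: power2_eq_square)
    then have "?n \<le> M"
      using M(1) by (cases "?n = 0") auto
    then have "?n * M \<le> M\<^sup>2"
      using M(1) by (simp add: power2_eq_square)
    then have "\<kappa> * (norm (pi_mult p y))\<^sup>2 \<le> M\<^sup>2"
      using \<kappa>(2)[OF y, of "pi_mult p y"] le by (simp flip: inner_A)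
    then show ?thesis
      using \<kappa>(1) by (intro real_le_rsqrt) (simp add: field_simps)
  qed
  have "s_val p \<gamma>0 y \<le> sqrt (M\<^sup>2 / \<kappa>) + \<gamma>0" if "y \<in> K" for y
  proof -
    have "\<bar>pi_mult p y $ i\<bar> \<le> sqrt (M\<^sup>2 / \<kappa>)" for i
      using pi[OF that] component_le_norm_cart[of "pi_mult p y" i] by linarith
    then show ?thesis
      using \<kappa>(1) by (auto simp: s_val_def)
  qed
  then show ?thesis by blast
qed

text \<open>An energy estimate for the saddle point system: pairing the equations with
  \<open>v\<close> and \<open>h\<close> shows that the energy \<open>E\<close> equals
  \<open>w\<close> times the sum of the entries of \<open>h\<close>. Coercivity bounds the square of
  \<open>norm h\<close> by a multiple of \<open>E\<close>, and the lower bound on \<open>H\<close>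
  does the same for \<open>v\<close>. The constant depends on neither \<open>H\<close> nor
  \<open>e\<close>.\<close>

lemma Gamma_solution_bounded_on_compact:
  assumes K: "compact K" and a: "a > 0" and b: "b > 0"
  shows "\<exists>C>0. \<forall>y\<in>K. \<forall>H e v h w. sym_pos_def H \<longrightarrow>
    (\<forall>v. a * (norm v)\<^sup>2 \<le> v \<bullet> (H *v v) \<and> v \<bullet> (H *v v) \<le> b * (norm v)\<^sup>2) \<longrightarrow> w \<ge> 0 \<longrightarrow>
    Gamma_mat H y e *v stack v h = stack 0 (- w *\<^sub>R (\<chi> i. 1)) \<longrightarrow> norm v \<le> C * w \<and> norm h \<le> C * w"
proof -
  \<comment> \<open>The exponent is \<open>2\<close> because the square of \<open>fbar i y\<close>
    is controlled by the diagonal entry \<open>Q i\<close>.\<close>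
  obtain \<kappa> where \<kappa>: "\<kappa> > 0" "\<And>y u. y \<in> K \<Longrightarrow>
    \<kappa> * (norm u)\<^sup>2 \<le> (norm (Nmat y *v u))\<^sup>2 + (\<Sum>i\<in>I1. \<bar>fbar i y\<bar> powr 2 * (u $ i)\<^sup>2)"
    using coercive_on_compact[OF K, of 2] zero_less_numeral by blast
  obtain M where M: "M \<ge> 1" "\<And>y i. y \<in> K \<Longrightarrow> norm (g i y) \<le> M"
    using gradients_bounded_on_compact[OF K] by blast
  define m where "m = real CARD('m)"
  define Ch where "Ch = (b + M) * m / \<kappa>"
  define Cv where "Cv = sqrt (m * Ch / a)"
  have pos: "m > 0" "Ch > 0" "Cv > 0"
    using \<kappa>(1) M(1) a b by (auto simp: m_def Ch_def Cv_def)
  have "norm v \<le> Cv * w \<and> norm h \<le> Ch * w"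
    if y: "y \<in> K" and H: "sym_pos_def H"
      and ab: "\<And>v. a * (norm v)\<^sup>2 \<le> v \<bullet> (H *v v) \<and> v \<bullet> (H *v v) \<le> b * (norm v)\<^sup>2"
      and w: "w \<ge> 0" and eq: "Gamma_mat H y e *v stack v h = stack 0 (- w *\<^sub>R (\<chi> i. 1))"
    for y H e v h w
  proof -
    define Q where "Q i = \<bar>fbar i y\<bar> * (\<bar>fbar i y + g i y \<bullet> e\<bar> + norm e)" for i
    note e1 = Gamma_solution_eqs(1)[OF eq] and e2 = Gamma_solution_eqs(2)[OF eq]
    have e2i: "g i y \<bullet> v = Q i * h $ i - w" for i
      using arg_cong[OF e2[unfolded transpose_Nmat_mult], of "\<lambda>z. z $ i"]
      by (simp add: Qmat_def diag_mat_mult Q_def)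
    define E where "E = v \<bullet> (H *v v) + (\<Sum>i\<in>UNIV. Q i * (h $ i)\<^sup>2)"
    have "v \<bullet> (H *v v) = - (\<Sum>i\<in>UNIV. h $ i * (g i y \<bullet> v))"
      by (simp add: e1 Nmat_mult inner_sum_right inner_commute)
    then have "E = w * (\<Sum>i\<in>UNIV. h $ i)"
      by (simp add: E_def e2i power2_eq_square algebra_simps sum_subtractf sum_distrib_left)
    also have "\<dots> \<le> w * (m * norm h)"
    proof (intro mult_left_mono w)
      have "(\<Sum>i\<in>UNIV. h $ i) \<le> (\<Sum>i\<in>(UNIV::'m set). norm h)"
        by (intro sum_mono) (metis abs_le_D1 component_le_norm_cart)
      then show "(\<Sum>i\<in>UNIV. h $ i) \<le> m * norm h" by (simp add: m_def)
    qed
    finally have E_le: "E \<le> w * (m * norm h)" .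
    have Q_nonneg: "Q i \<ge> 0" for i by (simp add: Q_def)
    have vHv: "0 \<le> v \<bullet> (H *v v)" for v
      using H by (cases "v = 0") (auto simp: sym_pos_def_def less_imp_le)
    \<comment> \<open>Writing \<open>fbar i y\<close> as
      \<open>(fbar i y + g i y \<bullet> e) - g i y \<bullet> e\<close> bounds it by
      \<open>M\<close> times the second factor of \<open>Q i\<close>.\<close>
    have fbar_sq: "\<bar>fbar i y\<bar> powr 2 \<le> M * Q i" for i
    proof -
      have "\<bar>g i y \<bullet> e\<bar> \<le> M * norm e"
        using Cauchy_Schwarz_ineq2[of "g i y" e] mult_right_mono[OF M(2)[OF y, of i], of "norm e"] by simp
      moreover have "\<bar>fbar i y + g i y \<bullet> e\<bar> \<le> M * \<bar>fbar i y + g i y \<bullet> e\<bar>"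
        using mult_right_mono[OF M(1), of "\<bar>fbar i y + g i y \<bullet> e\<bar>"] by simp
      ultimately have "\<bar>fbar i y\<bar> \<le> M * (\<bar>fbar i y + g i y \<bullet> e\<bar> + norm e)"
        unfolding distrib_left by linarith
      then have "\<bar>fbar i y\<bar> * \<bar>fbar i y\<bar> \<le> \<bar>fbar i y\<bar> * (M * (\<bar>fbar i y + g i y \<bullet> e\<bar> + norm e))"
        by (rule mult_left_mono) simp
      then show ?thesis
        by (simp add: Q_def powr_numeral power2_eq_square mult_ac)
    qed
    have "\<kappa> * (norm h)\<^sup>2 \<le> (norm (Nmat y *v h))\<^sup>2 + (\<Sum>i\<in>I1. \<bar>fbar i y\<bar> powr 2 * (h $ i)\<^sup>2)"
      by (rule \<kappa>(2)[OF y])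
    also have "\<dots> \<le> b * (v \<bullet> (H *v v)) + M * (\<Sum>i\<in>UNIV. Q i * (h $ i)\<^sup>2)"
    proof (rule add_mono)
      \<comment> \<open>The first block equation turns the norm of \<open>Nmat y *v h\<close> into
        that of \<open>H *v v\<close>, which is part of the energy.\<close>
      have "norm (Nmat y *v h) = norm (H *v v)" by (simp add: e1)
      then show "(norm (Nmat y *v h))\<^sup>2 \<le> b * (v \<bullet> (H *v v))"
        using norm_sq_mult_le[of H b v] H b ab vHv by (simp add: sym_pos_def_def)
      have "(\<Sum>i\<in>I1. \<bar>fbar i y\<bar> powr 2 * (h $ i)\<^sup>2) \<le> (\<Sum>i\<in>I1. M * (Q i * (h $ i)\<^sup>2))"
        using mult_right_mono[OF fbar_sq] by (intro sum_mono) (simp add: mult.assoc)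
      also have "\<dots> \<le> (\<Sum>i\<in>UNIV. M * (Q i * (h $ i)\<^sup>2))"
        using M(1) Q_nonneg by (intro sum_mono2) auto
      finally show "(\<Sum>i\<in>I1. \<bar>fbar i y\<bar> powr 2 * (h $ i)\<^sup>2) \<le> M * (\<Sum>i\<in>UNIV. Q i * (h $ i)\<^sup>2)"
        by (simp add: sum_distrib_left)
    qed
    also have "\<dots> \<le> (b + M) * E"
      using b M(1) vHv[of v] sum_nonneg[of UNIV "\<lambda>i. Q i * (h $ i)\<^sup>2"] Q_nonneg
      by (simp add: E_def algebra_simps)
    also have "\<dots> \<le> (b + M) * (w * (m * norm h))"
      using b M(1) by (intro mult_left_mono E_le) auto
    finally have "norm h * norm h \<le> norm h * (Ch * w)"
      using \<kappa>(1) by (simp add: Ch_def field_simps power2_eq_square)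
    then have h: "norm h \<le> Ch * w"
      using pos w by (cases "norm h = 0") auto
    have "a * (norm v)\<^sup>2 \<le> E"
      using ab[of v] sum_nonneg[of UNIV "\<lambda>i. Q i * (h $ i)\<^sup>2"] Q_nonneg by (simp add: E_def)
    also have "\<dots> \<le> w * (m * (Ch * w))"
      using E_le mult_left_mono[OF mult_left_mono[OF h], of m w] pos w by linarith
    finally have "(norm v)\<^sup>2 \<le> m * Ch / a * w\<^sup>2"
      using a by (simp add: field_simps power2_eq_square)
    then have "norm v \<le> sqrt (m * Ch / a * w\<^sup>2)"
      by (rule real_le_rsqrt)
    then show ?thesis
      using h w unfolding real_sqrt_mult Cv_def by simp
  qed
  note bound = this
  show ?thesis
  proof (intro exI[of _ "max Cv Ch"] conjI ballI allI impI)
    show "max Cv Ch > 0" using pos by simp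
  next
    fix y H e v h and w :: real
    assume *: "y \<in> K" "sym_pos_def H"
      "\<forall>v. a * (norm v)\<^sup>2 \<le> v \<bullet> (H *v v) \<and> v \<bullet> (H *v v) \<le> b * (norm v)\<^sup>2" "w \<ge> 0"
      "Gamma_mat H y e *v stack v h = stack 0 (- w *\<^sub>R (\<chi> i. 1))"
    have "norm v \<le> Cv * w \<and> norm h \<le> Ch * w"
      by (rule bound[OF *(1,2) spec[OF *(3)] *(4,5)])
    moreover have "Cv * w \<le> max Cv Ch * w" "Ch * w \<le> max Cv Ch * w"
      using *(4) by (intro mult_right_mono; simp)+
    ultimately show "norm v \<le> max Cv Ch * w" "norm h \<le> max Cv Ch * w"
      by linarith+
  qed
qed

end


section \<open>The line search of Step 6\<close>

lemma norm_add_sq_le: "(norm (u + v))\<^sup>2 \<le> 2 * (norm u)\<^sup>2 + 2 * (norm v)\<^sup>2"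
proof -
  have "(norm (u + v))\<^sup>2 \<le> (norm u + norm v)\<^sup>2"
    by (intro power_mono norm_triangle_ineq) auto
  also have "\<dots> \<le> 2 * (norm u)\<^sup>2 + 2 * (norm v)\<^sup>2"
    using sum_squares_bound[of "norm u" "norm v"] by (simp add: power2_sum)
  finally show ?thesis .
qed

context nlp
begin

text \<open>Here \<open>e\<close> and \<open>v\<close> stand for \<open>d0\<close> and
  \<open>d1\<close>. Besides the decrease \<open>s * (b * w)\<close>, the linear terms leave a
  nonnegative multiple of \<open>fbar i y \<le> 0\<close>, and the share \<open>1 - A\<close> of the
  decrease absorbs the second order term. The difference \<open>f i y - fbar i y\<close> is
  \<open>0\<close> or \<open>phi y\<close> according to the sign of \<open>f i y\<close>, so one
  inequality serves both kinds of constraints.\<close>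

lemma constraint_step:
  assumes dh: "dh = (1 - b) *\<^sub>R e + b *\<^sub>R v" and b: "0 \<le> b" "b \<le> 1"
    and feasible: "fbar i y + g i y \<bullet> e \<le> 0"
    and v: "g i y \<bullet> v \<le> - w + \<bar>fbar i y\<bar> * K" and K: "0 \<le> K"
    and taylor: "f i (y + s *\<^sub>R dh) \<le> f i y + s * (g i y \<bullet> dh) + L * (s\<^sup>2 * (norm dh)\<^sup>2)"
    and L: "0 \<le> L" and w: "0 \<le> w" and dh_le: "(norm dh)\<^sup>2 \<le> C * (b * w)"
    and s: "0 \<le> s" "s * (1 + K) \<le> 1" "s * (L * C) \<le> 1 - A"
  shows "f i (y + s *\<^sub>R dh) \<le> (f i y - fbar i y) - A * s * (b * w)"
proof -
  have "(1 - b) * (g i y \<bullet> e) \<le> (1 - b) * (- fbar i y)"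
    using feasible b by (intro mult_left_mono) auto
  moreover have "b * (g i y \<bullet> v) \<le> b * (- w - fbar i y * K)"
    using v b fbar_nonpos[of i y] by (intro mult_left_mono) auto
  ultimately have "g i y \<bullet> dh \<le> - fbar i y + b * fbar i y * (1 - K) - b * w"
    by (simp add: dh inner_add_right algebra_simps)
  then have lin: "s * (g i y \<bullet> dh) \<le> s * (- fbar i y + b * fbar i y * (1 - K) - b * w)"
    using s by (intro mult_left_mono)
  have "L * (s\<^sup>2 * (norm dh)\<^sup>2) \<le> L * (s\<^sup>2 * (C * (b * w)))"
    using dh_le L by (intro mult_left_mono) auto
  also have "\<dots> = (s * (L * C)) * (s * (b * w))"
    by (simp add: power2_eq_square mult_ac)
  also have "\<dots> \<le> (1 - A) * (s * (b * w))"
    using s b w by (intro mult_right_mono) auto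
  finally have quad: "L * (s\<^sup>2 * (norm dh)\<^sup>2) \<le> (1 - A) * (s * (b * w))" .
  have "s * (1 - b + b * K) \<le> s * (1 + K)"
    using b K s by (intro mult_left_mono add_mono) (auto intro: mult_left_le_one_le)
  \<comment> \<open>This is everything multiplying \<open>fbar i y\<close> once one copy has been
    split off for the conclusion.\<close>
  then have "fbar i y * (1 - s * (1 - b + b * K)) \<le> 0"
    using s fbar_nonpos[of i y] by (intro mult_nonpos_nonneg) auto
  then show ?thesis
    using taylor lin quad by (simp add: algebra_simps)
qed

text \<open>Satisfied constraints stay satisfied, so the count in the line search test follows from
  an inclusion of index sets.\<close>

lemma constraints_accepted:
  assumes "\<And>i. f i z \<le> (f i y - fbar i y) - r" "0 \<le> r"
  shows "f i z \<le> max 0 (phi y - r)" "card (Iminus y) \<le> card (Iminus z)"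
proof -
  have cases: "f i z \<le> (if i \<in> Iminus y then 0 else phi y) - r" for i
    using assms(1)[of i] by (simp add: fbar_def split: if_splits)
  show "f i z \<le> max 0 (phi y - r)"
    using cases[of i] assms(2) by (cases "i \<in> Iminus y") auto
  have "Iminus y \<subseteq> Iminus z"
  proof
    fix i assume "i \<in> Iminus y"
    then show "i \<in> Iminus z"
      using cases[of i] assms(2) by (simp add: Iminus_def)
  qed
  then show "card (Iminus y) \<le> card (Iminus z)"
    by (simp add: card_mono)
qed

text \<open>The test leaves the slack \<open>(1 - A) * (\<rho> * P - G \<bullet> dh)\<close>, and
  the slope bound makes it at least \<open>(1 - A) * ((\<rho> - 1) * P + \<theta> * q * E)\<close>.
  This dominates a second order term of size \<open>P + E\<close> for small \<open>s\<close>. In the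
  application \<open>P\<close> is \<open>phi powr \<theta>\<close> and \<open>E\<close> is the
  square of the norm of \<open>d0\<close>.\<close>

lemma objective_step:
  assumes slope: "G \<bullet> dh \<le> \<theta> * S0 + P" and S0: "S0 \<le> - q * E" and \<theta>: "0 < \<theta>"
    and taylor: "F c (y + s *\<^sub>R dh) \<le> F c y + s * (G \<bullet> dh) + L * (s\<^sup>2 * (norm dh)\<^sup>2)"
    and L: "0 \<le> L" and dh_le: "(norm dh)\<^sup>2 \<le> C * (P + E)" and PE: "0 \<le> P" "0 \<le> E"
    and s: "0 \<le> s" "s * (L * C) \<le> (1 - A) * min (\<rho> - 1) (\<theta> * q)" and A: "A < 1"
  shows "F c (y + s *\<^sub>R dh) \<le> F c y + A * s * (G \<bullet> dh) + \<rho> * (1 - A) * s * P"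
proof -
  have "\<theta> * S0 \<le> - (\<theta> * q * E)"
    using mult_left_mono[OF S0, of \<theta>] \<theta> by simp
  then have Gdh: "G \<bullet> dh \<le> P - \<theta> * q * E"
    using slope by linarith
  have "L * (s * (norm dh)\<^sup>2) \<le> L * (s * (C * (P + E)))"
    using dh_le L s by (intro mult_left_mono) auto
  also have "\<dots> = s * (L * C) * (P + E)"
    by (simp add: mult_ac)
  also have "\<dots> \<le> (1 - A) * min (\<rho> - 1) (\<theta> * q) * (P + E)"
    using s PE by (intro mult_right_mono) auto
  also have "\<dots> = (1 - A) * (min (\<rho> - 1) (\<theta> * q) * P + min (\<rho> - 1) (\<theta> * q) * E)"
    by (simp add: algebra_simps)
  also have "\<dots> \<le> (1 - A) * ((\<rho> - 1) * P + \<theta> * q * E)"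
    using PE A by (intro mult_left_mono add_mono mult_right_mono) auto
  also have "\<dots> \<le> (1 - A) * (\<rho> * P - G \<bullet> dh)"
    using Gdh A by (intro mult_left_mono) (auto simp: algebra_simps)
  finally have "s * (L * (s * (norm dh)\<^sup>2)) \<le> s * ((1 - A) * (\<rho> * P - G \<bullet> dh))"
    using s by (intro mult_left_mono)
  then show ?thesis
    using taylor by (simp add: power2_eq_square algebra_simps)
qed

end

text \<open>The slope condition is affine in the weight: its slack at weight \<open>0\<close> is at
  least \<open>(1 - \<theta>) * s + P\<close> and decreases at rate at most \<open>C * w\<close>.
  The maximal weight is therefore at least \<open>1\<close> or the quotient of the two.\<close>

lemma convex_weight_arg_max:
  fixes G :: "'a::real_inner"
  assumes max: "is_arg_max (\<lambda>b. b)
      (\<lambda>b. 0 \<le> b \<and> b \<le> 1 \<and> G \<bullet> ((1 - b) *\<^sub>R e + b *\<^sub>R v) \<le> \<theta> * (G \<bullet> e) + P) \<beta>"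
    and e: "s \<le> - (G \<bullet> e)" "0 \<le> s" and \<theta>: "\<theta> < 1" and P: "0 \<le> P"
    and diff: "G \<bullet> v - G \<bullet> e \<le> C * w" and pos: "C > 0" "w > 0"
  shows "0 \<le> \<beta>" "\<beta> \<le> 1" "G \<bullet> ((1 - \<beta>) *\<^sub>R e + \<beta> *\<^sub>R v) \<le> \<theta> * (G \<bullet> e) + P"
    "min w (((1 - \<theta>) * s + P) / C) \<le> \<beta> * w"
proof -
  show "0 \<le> \<beta>" "\<beta> \<le> 1" "G \<bullet> ((1 - \<beta>) *\<^sub>R e + \<beta> *\<^sub>R v) \<le> \<theta> * (G \<bullet> e) + P"
    using max by (auto simp: is_arg_max_def)
  define T where "T = (1 - \<theta>) * s + P"
  define b where "b = min 1 (T / (C * w))"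
  have T: "0 \<le> T" using e \<theta> P by (simp add: T_def)
  have b: "0 \<le> b" "b \<le> 1" using T pos by (auto simp: b_def)
  have "b * (G \<bullet> v - G \<bullet> e) \<le> b * (C * w)"
    using diff b by (intro mult_left_mono)
  also have "\<dots> \<le> T / (C * w) * (C * w)"
    using pos by (intro mult_right_mono) (auto simp: b_def)
  also have "\<dots> = T" using pos by simp
  also have "\<dots> \<le> (1 - \<theta>) * (- (G \<bullet> e)) + P"
    unfolding T_def using e \<theta> by (intro add_right_mono mult_left_mono) auto
  finally have "G \<bullet> ((1 - b) *\<^sub>R e + b *\<^sub>R v) \<le> \<theta> * (G \<bullet> e) + P"
    by (simp add: inner_add_right algebra_simps)
  then have "b \<le> \<beta>"
    using max b by (auto simp: is_arg_max_def not_less)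
  then have "b * w \<le> \<beta> * w"
    using pos by (intro mult_right_mono) auto
  moreover have "b * w = min w (T / C)"
    using pos by (simp add: b_def min_def field_simps)
  ultimately show "min w (((1 - \<theta>) * s + P) / C) \<le> \<beta> * w"
    by (simp add: T_def)
qed

context regular_nlp
begin

text \<open>One constant serves all constraints and, since \<open>F c\<close> is affine in
  \<open>c\<close>, all penalty parameters in a bounded range.\<close>

lemma taylor_on_ball:
  fixes R S :: real
  shows "\<exists>L\<ge>0. \<forall>y\<in>cball 0 R. \<forall>z\<in>cball 0 R.
    (\<forall>i. f i z \<le> f i y + g i y \<bullet> (z - y) + L * (norm (z - y))\<^sup>2) \<and>
    (\<forall>c. \<bar>c\<bar> \<le> S \<longrightarrow> F c z \<le> F c y + gradient (F c) y \<bullet> (z - y) + L * (norm (z - y))\<^sup>2)"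
proof -
  obtain L0 where L0: "L0 \<ge> 0" "\<And>y z. y \<in> cball 0 R \<Longrightarrow> z \<in> cball 0 R \<Longrightarrow>
      \<bar>f0 z - f0 y - gradient f0 y \<bullet> (z - y)\<bar> \<le> L0 * (norm (z - y))\<^sup>2"
    using twice_cont_diff_taylor[OF smooth0] by blast
  have "\<exists>L\<ge>0. \<forall>y\<in>cball (0::real^'n) R. \<forall>z\<in>cball 0 R. \<bar>f i z - f i y - g i y \<bullet> (z - y)\<bar> \<le> L * (norm (z - y))\<^sup>2" for i
    unfolding g_def by (rule twice_cont_diff_taylor[OF smooth[of i]]) blast
  then obtain L1 where L1: "\<And>i. L1 i \<ge> 0" "\<And>i y z. y \<in> cball 0 R \<Longrightarrow> z \<in> cball 0 R \<Longrightarrow>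
      \<bar>f i z - f i y - g i y \<bullet> (z - y)\<bar> \<le> L1 i * (norm (z - y))\<^sup>2"
    by metis
  define SL where "SL = (\<Sum>i\<in>UNIV. L1 i)"
  define L where "L = L0 + (1 + \<bar>S\<bar>) * SL"
  have SL: "L1 i \<le> SL" for i
    unfolding SL_def by (rule member_le_sum) (auto simp: L1)
  have SL0: "0 \<le> SL" by (simp add: SL_def sum_nonneg L1)
  have SLL: "SL \<le> L" using L0(1) SL0 by (simp add: L_def algebra_simps)
  show ?thesis
  proof (intro exI[of _ L] conjI ballI allI impI)
    show "L \<ge> 0" using SL0 SLL by linarith
  next
    fix y z :: "real^'n" and i assume yz: "y \<in> cball 0 R" "z \<in> cball 0 R"
    have "L1 i * (norm (z - y))\<^sup>2 \<le> L * (norm (z - y))\<^sup>2"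
      using SL[of i] SLL by (intro mult_right_mono) auto
    then show "f i z \<le> f i y + g i y \<bullet> (z - y) + L * (norm (z - y))\<^sup>2"
      using L1(2)[OF yz, of i] by linarith
  next
    fix y z :: "real^'n" and c :: real assume yz: "y \<in> cball 0 R" "z \<in> cball 0 R" and c: "\<bar>c\<bar> \<le> S"
    let ?n = "(norm (z - y))\<^sup>2"
    have "\<bar>\<Sum>i\<in>I2. f i z - f i y - g i y \<bullet> (z - y)\<bar> \<le> (\<Sum>i\<in>I2. L1 i * ?n)"
      using L1(2)[OF yz] by (intro sum_abs[THEN order_trans] sum_mono) auto
    also have "\<dots> \<le> (\<Sum>i\<in>UNIV. L1 i * ?n)"
      using L1(1) by (intro sum_mono2) auto
    finally have "\<bar>\<Sum>i\<in>I2. f i z - f i y - g i y \<bullet> (z - y)\<bar> \<le> SL * ?n"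
      by (simp add: SL_def sum_distrib_right)
    then have "\<bar>c\<bar> * \<bar>\<Sum>i\<in>I2. f i z - f i y - g i y \<bullet> (z - y)\<bar> \<le> \<bar>S\<bar> * (SL * ?n)"
      using c by (intro mult_mono) auto
    then have "\<bar>c * (\<Sum>i\<in>I2. f i z - f i y - g i y \<bullet> (z - y))\<bar> \<le> \<bar>S\<bar> * SL * ?n"
      by (simp add: abs_mult mult_ac)
    moreover have "F c z - F c y - gradient (F c) y \<bullet> (z - y) =
        (f0 z - f0 y - gradient f0 y \<bullet> (z - y)) - c * (\<Sum>i\<in>I2. f i z - f i y - g i y \<bullet> (z - y))"
      by (simp add: F_def gradient_F inner_diff_left inner_sum_left sum_subtractf sum.distrib algebra_simps)
    moreover have "L0 * ?n + \<bar>S\<bar> * SL * ?n \<le> L * ?n"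
      using SL0 by (simp add: L_def algebra_simps)
    ultimately show "F c z \<le> F c y + gradient (F c) y \<bullet> (z - y) + L * ?n"
      using L0(2)[OF yz] by linarith
  qed
qed

end


section \<open>Runs with bounded iterates\<close>

locale regular_run = algorithm_A_run f0 f I2 p \<epsilon> \<gamma> \<gamma>0 c_init \<rho> \<theta> \<sigma> \<eta> \<alpha> \<alpha>' \<tau> x c H d0 d1 d2 d h1 h2 \<beta> t +
    regular_nlp f0 f I2
  for f0 :: "real^'n \<Rightarrow> real"
    and f :: "'m::finite \<Rightarrow> real^'n \<Rightarrow> real"
    and I2 :: "'m set"
    and p \<epsilon> \<gamma> \<gamma>0 c_init \<rho> \<theta> \<sigma> \<eta> \<alpha> \<alpha>' \<tau> :: real
    and x c H d0 d1 d2 d h1 h2 \<beta> t +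
  assumes bounded_iterates: "bounded (range x)"
    and H_bounds: "\<exists>a>0. \<exists>b>0. \<forall>k v. a * (norm v)\<^sup>2 \<le> v \<bullet> (H k *v v) \<and> v \<bullet> (H k *v v) \<le> b * (norm v)\<^sup>2"
begin

abbreviation w :: "nat \<Rightarrow> real" where
  "w k \<equiv> norm (d0 k) + phi (x k) powr \<sigma>"

abbreviation G :: "nat \<Rightarrow> real^'n" where
  "G k \<equiv> gradient (F (c k)) (x k)"

abbreviation dhat :: "nat \<Rightarrow> real^'n" where
  "dhat k \<equiv> (1 - \<beta> k) *\<^sub>R d0 k + \<beta> k *\<^sub>R d1 k"

abbreviation test4 :: "nat \<Rightarrow> real \<Rightarrow> bool" where
  "test4 k \<equiv> search_test \<rho> \<theta> \<alpha> (c k) (x k) (d0 k + d2 k) (G k \<bullet> d0 k)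
     (norm (d0 k) powr \<tau> + phi (x k) powr \<sigma>)"

abbreviation test6 :: "nat \<Rightarrow> real \<Rightarrow> bool" where
  "test6 k \<equiv> search_test \<rho> \<theta> \<alpha>' (c k) (x k) (dhat k) (G k \<bullet> dhat k) (\<beta> k * w k)"

text \<open>In Step 4 the trial \<open>1\<close> is tested whatever the size of
  \<open>\<epsilon>\<close>, and later trials are at least \<open>\<epsilon>\<close>; hence the
  bound \<open>min 1 \<epsilon>\<close>.\<close>

lemma step_cases:
  obtains (step4) "test4 k (t k)" "min 1 \<epsilon> \<le> t k" "d k = d0 k + d2 k"
  | (step6) j where "Gamma_mat (H k) (x k) (d0 k) *v stack (d1 k) (h1 k) = stack 0 (- w k *\<^sub>R (\<chi> i. 1))"
      "is_arg_max (\<lambda>b. b) (\<lambda>b. 0 \<le> b \<and> b \<le> 1 \<and>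
         G k \<bullet> ((1 - b) *\<^sub>R d0 k + b *\<^sub>R d1 k) \<le> \<theta> * (G k \<bullet> d0 k) + phi (x k) powr \<theta>) (\<beta> k)"
      "t k = \<eta> ^ j" "test6 k (t k)" "\<forall>l<j. \<not> test6 k (\<eta> ^ l)" "d k = dhat k"
proof (cases "\<exists>s. \<exists>j::nat. s = (1/2) ^ j \<and> (j = 0 \<or> s \<ge> \<epsilon>) \<and> test4 k s \<and> (\<forall>l<j. \<not> test4 k ((1/2) ^ l))")
  case True
  then have "\<exists>j::nat. t k = (1/2) ^ j \<and> (j = 0 \<or> t k \<ge> \<epsilon>) \<and> test4 k (t k)" "d k = d0 k + d2 k"
    using step456[of k] unfolding Let_def by (auto simp only: if_True)
  then show ?thesis
    using step4 by fastforce
next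
  case False
  then show ?thesis
    using step456[of k] unfolding Let_def by (simp only: if_False) (elim conjE exE, rule step6)
qed

text \<open>The parameter changes only when it lies below the current \<open>s_val\<close>, which is
  at most \<open>S\<close> on the closure of the iterates, and then it rises to at most
  \<open>S + \<gamma>\<close>.\<close>

lemma c_bounded: "\<exists>S. \<forall>k. \<bar>c k\<bar> \<le> S"
proof -
  have "compact (closure (range x))"
    using bounded_iterates by simp
  then obtain S where "\<forall>y \<in> closure (range x). s_val p \<gamma>0 y \<le> S"
    using s_val_bounded_on_compact[OF _ positive_params(1)] by blast
  then have S: "s_val p \<gamma>0 (x k) \<le> S" for k
    using closure_subset[of "range x"] by blast
  have "c_init \<le> c k \<and> c k \<le> max c_init (S + \<gamma>)" for k
  proof (induction k)
    case 0
    show ?case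
      using step1[of 0] S[of 0] positive_params(3) by (auto simp: Let_def split: if_splits)
  next
    case (Suc k)
    then show ?case
      using step1[of "Suc k"] S[of "Suc k"] positive_params(3) by (auto simp: Let_def split: if_splits)
  qed
  then have "\<bar>c k\<bar> \<le> \<bar>max c_init (S + \<gamma>)\<bar>" for k
    using positive_params(5) by (smt (verit))
  then show ?thesis by blast
qed

lemma d0_feasible: "fbar i (x k) + g i (x k) \<bullet> d0 k \<le> 0"
  using step2[of k] by (simp add: QP_solution_def is_arg_min_linorder)

lemma d0_descent:
  assumes "\<And>v. a * (norm v)\<^sup>2 \<le> v \<bullet> (H k *v v)"
  shows "a / 2 * (norm (d0 k))\<^sup>2 \<le> - (G k \<bullet> d0 k)"
proof -
  \<comment> \<open>Since \<open>fbar\<close> is nonpositive, \<open>0\<close> is feasible for the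
    quadratic program and can be compared with its minimizer.\<close>
  have "G k \<bullet> d0 k + 1/2 * (d0 k \<bullet> (H k *v d0 k)) \<le> G k \<bullet> 0 + 1/2 * (0 \<bullet> (H k *v 0))"
    using step2[of k] unfolding QP_solution_def is_arg_min_linorder
    by (elim conjE allE[of _ 0]) (simp add: fbar_nonpos)
  with assms[of "d0 k"] show ?thesis by simp
qed

lemma phi_step:
  assumes "search_test \<rho> \<theta> A (c k) (x k) (d k) sl r (t k)"
  shows "phi (x (Suc k)) \<le> max 0 (phi (x k) - A * t k * r)"
  using assms unfolding search_test_def step7 phi_le_iff[of "x k + t k *\<^sub>R d k"] by simp

text \<open>Every step length up to a fixed \<open>tb\<close> passes the test of Step 6, so
  backtracking through rejected trials cannot go below \<open>\<eta> * tb\<close>. The maximal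
  weight makes \<open>\<beta> k * w k\<close> at least a multiple of
  \<open>phi (x k) powr \<sigma>\<close>. The product controls the decrease of
  \<open>phi\<close>.\<close>

lemma line_search_step_bound:
  shows "\<exists>\<kappa>>0. \<forall>k j. 0 < phi (x k) \<longrightarrow> phi (x k) \<le> 1 \<longrightarrow>
    Gamma_mat (H k) (x k) (d0 k) *v stack (d1 k) (h1 k) = stack 0 (- w k *\<^sub>R (\<chi> i. 1)) \<longrightarrow>
    is_arg_max (\<lambda>b. b) (\<lambda>b. 0 \<le> b \<and> b \<le> 1 \<and>
      G k \<bullet> ((1 - b) *\<^sub>R d0 k + b *\<^sub>R d1 k) \<le> \<theta> * (G k \<bullet> d0 k) + phi (x k) powr \<theta>) (\<beta> k) \<longrightarrow>
    (\<forall>l<j. \<not> test6 k (\<eta> ^ l)) \<longrightarrow> \<kappa> * phi (x k) powr \<sigma> \<le> \<eta> ^ j * (\<beta> k * w k)"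
proof -

  \<comment> \<open>Constants independent of the iteration\<close>
  obtain R0 where R0: "\<And>k. x k \<in> cball 0 R0"
    using bounded_iterates by (auto simp: bounded_iff)
  have compact: "compact (cball (0::real^'n) R0)" by simp
  obtain a b where a: "a > 0" and b: "b > 0"
    and ab: "\<And>k v. a * (norm v)\<^sup>2 \<le> v \<bullet> (H k *v v) \<and> v \<bullet> (H k *v v) \<le> b * (norm v)\<^sup>2"
    using H_bounds by blast
  obtain S where S: "\<And>k. \<bar>c k\<bar> \<le> S"
    using c_bounded by blast
  then have S0: "S \<ge> 0" by (meson abs_ge_zero order_trans)
  obtain M where M: "M \<ge> 1" "\<And>y. y \<in> cball 0 R0 \<Longrightarrow> norm (gradient f0 y) \<le> M"
      "\<And>y i. y \<in> cball 0 R0 \<Longrightarrow> norm (g i y) \<le> M"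
    using gradients_bounded_on_compact[OF compact] by blast
  obtain Mf where Mf: "\<And>i k. \<bar>f i (x k)\<bar> \<le> Mf"
  proof -
    have "bounded (\<Union>i. f i ` cball 0 R0)"
      by (intro bounded_UN finite ballI compact_imp_bounded compact_continuous_image
          continuous_on_f compact)
    then obtain B where "\<forall>v \<in> (\<Union>i. f i ` cball 0 R0). norm v \<le> B"
      unfolding bounded_iff by (elim exE)
    then show ?thesis
      using R0 by (intro that[of B]) force
  qed
  have Mf0: "Mf \<ge> 0" using Mf by (meson abs_ge_zero order_trans)
  define MG where "MG = M + S * (card I2 * M)"
  have MG1: "MG \<ge> 1" using M(1) S0 by (simp add: MG_def add_increasing2)
  have G: "norm (G k) \<le> MG" for k
  proof -
    have "norm (\<Sum>i\<in>I2. g i (x k)) \<le> card I2 * M"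
      using M(3)[OF R0] by (intro sum_norm_bound)
    then have "norm (c k *\<^sub>R (\<Sum>i\<in>I2. g i (x k))) \<le> S * (card I2 * M)"
      using S S0 by (simp add: mult_mono)
    then show ?thesis
      unfolding gradient_F MG_def
      using M(2)[OF R0[of k]] norm_triangle_ineq4[of "gradient f0 (x k)"] by (smt (verit))
  qed
  \<comment> \<open>A bound for \<open>norm (d0 k)\<close>, from descent along \<open>d0 k\<close>
    against the bound \<open>MG\<close> on the gradient.\<close>
  define D where "D = 2 * MG / a"
  have D0: "D > 0" using MG1 a by (simp add: D_def)
  have descent: "a / 2 * (norm (d0 k))\<^sup>2 \<le> - (G k \<bullet> d0 k)" for k
    using d0_descent ab by blast
  have D: "norm (d0 k) \<le> D" for k
  proof -
    have "- (G k \<bullet> d0 k) \<le> MG * norm (d0 k)"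
      using Cauchy_Schwarz_ineq2[of "G k" "d0 k"] mult_right_mono[OF G[of k], of "norm (d0 k)"] by simp
    then have "norm (d0 k) * norm (d0 k) \<le> norm (d0 k) * D"
      using descent[of k] a by (simp add: D_def power2_eq_square field_simps)
    then show ?thesis
      using D0 by (cases "norm (d0 k) = 0") auto
  qed
  obtain C where C: "C > 0" "\<forall>y\<in>cball 0 R0. \<forall>H e v h w. sym_pos_def H \<longrightarrow>
      (\<forall>v. a * (norm v)\<^sup>2 \<le> v \<bullet> (H *v v) \<and> v \<bullet> (H *v v) \<le> b * (norm v)\<^sup>2) \<longrightarrow> w \<ge> 0 \<longrightarrow>
      Gamma_mat H y e *v stack v h = stack 0 (- w *\<^sub>R (\<chi> i. 1)) \<longrightarrow> norm v \<le> C * w \<and> norm h \<le> C * w"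
    using Gamma_solution_bounded_on_compact[OF compact a b] by blast
  \<comment> \<open>A bound for \<open>w k\<close>, as \<open>phi (x k) \<le> 1\<close>.\<close>
  define W where "W = D + 1"
  have W0: "W > 0" using D0 by (simp add: W_def)
  \<comment> \<open>\<open>D + C * W\<close> bounds the search direction, so this ball contains all
    trial points of step length at most \<open>1\<close>.\<close>
  let ?B = "cball (0::real^'n) (R0 + (D + C * W))"
  obtain L where L: "L \<ge> 0" "\<forall>y\<in>?B. \<forall>z\<in>?B.
      (\<forall>i. f i z \<le> f i y + g i y \<bullet> (z - y) + L * (norm (z - y))\<^sup>2) \<and>
      (\<forall>c. \<bar>c\<bar> \<le> S \<longrightarrow> F c z \<le> F c y + gradient (F c) y \<bullet> (z - y) + L * (norm (z - y))\<^sup>2)"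
    using taylor_on_ball by blast
  define K where "K = (Mf + 1 + M * D + D) * (C * W)"
  have K0: "K \<ge> 0"
    using Mf0 M(1) D0 C(1) W0 by (simp add: K_def)
  define C2 where "C2 = MG * (C + 1)"
  have C20: "C2 > 0" using MG1 C(1) by (simp add: C2_def)
  have \<theta>1: "\<theta> < 1" using theta unit_params by auto
  \<comment> \<open>\<open>\<beta> k * w k\<close> will be at least \<open>c3\<close> times the
    square of \<open>norm (d0 k)\<close> and at least \<open>c4 * phi (x k) powr \<sigma>\<close>;
    each minimum covers the two alternatives in the lower bound on the weight.\<close>
  define c3 where "c3 = min (1 / D) ((1 - \<theta>) * (a / 2) / C2)"
  define c4 where "c4 = min 1 (1 / C2)"
  have c34: "c3 > 0" "c4 > 0"
    using D0 C20 a \<theta>1 by (auto simp: c3_def c4_def)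
  \<comment> \<open>The squared norm of \<open>dhat k\<close> will be bounded by
    \<open>C5 * (\<beta> k * w k)\<close> for the constraints, and by \<open>C6\<close> times
    \<open>phi (x k) powr \<theta>\<close> plus the squared norm of \<open>d0 k\<close> for the
    objective.\<close>
  define C5 where "C5 = 2 / c3 + 2 * C\<^sup>2 * W"
  define C6 where "C6 = 2 * (1 + C)\<^sup>2"
  have C56: "C5 > 0" "C6 > 0"
    using c34 C(1) W0 by (auto simp: C5_def C6_def add_pos_nonneg)
  define \<mu> where "\<mu> = (1 - \<alpha>') * min (\<rho> - 1) (\<theta> * (a / 2))"
  have \<mu>0: "\<mu> > 0"
    using unit_params rho theta a by (simp add: \<mu>_def)
  \<comment> \<open>The three smallness conditions of \<open>constraint_step\<close> and
    \<open>objective_step\<close>; the added \<open>1\<close> keeps the denominators positive when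
    \<open>L = 0\<close>.\<close>
  define tb where "tb = min (1 / (1 + K)) (min ((1 - \<alpha>') / (L * C5 + 1)) (\<mu> / (L * C6 + 1)))"
  have LC: "L * C5 + 1 > 0" "L * C6 + 1 > 0"
    using L(1) C56 by (simp_all add: add_nonneg_pos)
  have tb0: "tb > 0"
    using K0 LC unit_params \<mu>0 by (auto simp: tb_def)
  have tb: "s * (1 + K) \<le> 1" "s * (L * C5) \<le> 1 - \<alpha>'" "s * (L * C6) \<le> \<mu>" "s \<le> 1"
    if s: "0 \<le> s" "s \<le> tb" for s
  proof -
    have "s \<le> 1 / (1 + K)" "s \<le> (1 - \<alpha>') / (L * C5 + 1)" "s \<le> \<mu> / (L * C6 + 1)"
      using s by (auto simp: tb_def)
    then have "s * (1 + K) \<le> 1" "s * (L * C5 + 1) \<le> 1 - \<alpha>'" "s * (L * C6 + 1) \<le> \<mu>"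
      using K0 LC by (simp_all add: pos_le_divide_eq)
    moreover have "s * K \<ge> 0" using s K0 by simp
    ultimately show "s * (1 + K) \<le> 1" "s * (L * C5) \<le> 1 - \<alpha>'" "s * (L * C6) \<le> \<mu>" "s \<le> 1"
      using s by (simp_all add: algebra_simps)
  qed
  show ?thesis
  proof (intro exI[of _ "\<eta> * tb * c4"] conjI allI impI)
    show "\<eta> * tb * c4 > 0" using unit_params tb0 c34 by simp
  next
    fix k j
    assume phi: "0 < phi (x k)" "phi (x k) \<le> 1"
      and \<Gamma>: "Gamma_mat (H k) (x k) (d0 k) *v stack (d1 k) (h1 k) = stack 0 (- w k *\<^sub>R (\<chi> i. 1))"
      and argmax: "is_arg_max (\<lambda>b. b) (\<lambda>b. 0 \<le> b \<and> b \<le> 1 \<and>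
        G k \<bullet> ((1 - b) *\<^sub>R d0 k + b *\<^sub>R d1 k) \<le> \<theta> * (G k \<bullet> d0 k) + phi (x k) powr \<theta>) (\<beta> k)"
      and rejected: "\<forall>l<j. \<not> test6 k (\<eta> ^ l)"

    \<comment> \<open>Estimates at a fixed iteration\<close>
    define P where "P = phi (x k) powr \<theta>"
    define B where "B = \<beta> k * w k"
    have powr: "0 < phi (x k) powr \<sigma>" "phi (x k) powr \<sigma> \<le> 1" "phi (x k) powr \<sigma> \<le> P" "0 \<le> P"
      using phi theta unit_params by (auto simp: P_def powr_le1 intro: powr_mono')
    have wk: "w k > 0" "w k \<le> W" "phi (x k) powr \<sigma> \<le> w k" "norm (d0 k) \<le> w k"
      using powr D[of k] norm_ge_zero[of "d0 k"] by (auto simp: W_def add_nonneg_pos)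
    have d1h1: "norm (d1 k) \<le> C * w k" "norm (h1 k) \<le> C * w k"
      using C(2)[rule_format, OF R0 H_spd ab _ \<Gamma>] wk(1) by auto
    have "G k \<bullet> d1 k - G k \<bullet> d0 k \<le> norm (G k) * norm (d1 k - d0 k)"
      using norm_cauchy_schwarz[of "G k" "d1 k - d0 k"] by (simp add: inner_diff_right)
    also have "\<dots> \<le> MG * (C * w k + w k)"
      using norm_triangle_ineq4[of "d1 k" "d0 k"] d1h1(1) wk(4) MG1
      by (intro mult_mono G) (linarith | simp)+
    finally have diff: "G k \<bullet> d1 k - G k \<bullet> d0 k \<le> C2 * w k"
      by (simp add: C2_def algebra_simps)
    have E0: "0 \<le> a / 2 * (norm (d0 k))\<^sup>2" using a by simp
    note \<beta> = convex_weight_arg_max[OF argmax descent[of k] E0 \<theta>1 _ diff C20 wk(1)]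
    have \<beta>01: "0 \<le> \<beta> k" "\<beta> k \<le> 1" and slope: "G k \<bullet> dhat k \<le> \<theta> * (G k \<bullet> d0 k) + P"
      and B_ge: "min (w k) (((1 - \<theta>) * (a / 2 * (norm (d0 k))\<^sup>2) + P) / C2) \<le> B"
      using \<beta> powr(4) by (auto simp: P_def B_def)
    have B: "0 \<le> B" "B \<le> w k"
      using \<beta>01 wk(1) by (auto simp: B_def intro: mult_left_le_one_le)
    \<comment> \<open>If the weight is \<open>1\<close>, then \<open>w k\<close> already contains
      \<open>phi (x k) powr \<sigma>\<close>; otherwise the slack contains \<open>P\<close>, which
      is at least as large because \<open>\<theta> < \<sigma>\<close> and
      \<open>phi (x k) \<le> 1\<close>.\<close>
    have B_phi: "c4 * phi (x k) powr \<sigma> \<le> B"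
    proof -
      have "c4 * phi (x k) powr \<sigma> \<le> w k"
      proof -
        have "c4 * phi (x k) powr \<sigma> \<le> 1 * phi (x k) powr \<sigma>"
          by (intro mult_right_mono) (auto simp: c4_def)
        with wk(3) show ?thesis by linarith
      qed
      moreover have "c4 * phi (x k) powr \<sigma> \<le> 1 / C2 * P"
        using powr C20 by (intro mult_mono) (auto simp: c4_def)
      moreover have "1 / C2 * P \<le> ((1 - \<theta>) * (a / 2 * (norm (d0 k))\<^sup>2) + P) / C2"
        using E0 \<theta>1 C20 by (auto intro!: divide_right_mono mult_nonneg_nonneg)
      ultimately show ?thesis using B_ge by linarith
    qed
    have B_d0: "c3 * (norm (d0 k))\<^sup>2 \<le> B"
    proof -
      have "c3 * (norm (d0 k))\<^sup>2 \<le> 1 / D * (norm (d0 k))\<^sup>2"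
        by (intro mult_right_mono) (auto simp: c3_def)
      also have "\<dots> \<le> norm (d0 k)"
        using D[of k] D0 mult_left_mono[OF D[of k], of "norm (d0 k)"]
        by (simp add: power2_eq_square field_simps)
      finally have "c3 * (norm (d0 k))\<^sup>2 \<le> w k" using wk by linarith
      moreover have "c3 * (norm (d0 k))\<^sup>2 \<le> (1 - \<theta>) * (a / 2) / C2 * (norm (d0 k))\<^sup>2"
        by (intro mult_right_mono) (auto simp: c3_def)
      moreover have "\<dots> \<le> ((1 - \<theta>) * (a / 2 * (norm (d0 k))\<^sup>2) + P) / C2"
        using powr(4) C20 by (simp add: field_simps)
      ultimately show ?thesis using B_ge by linarith
    qed
    have "\<beta> k * norm (d1 k) \<le> \<beta> k * (C * w k)"
      using \<beta>01 d1h1 by (intro mult_left_mono)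
    then have \<beta>d1: "norm (\<beta> k *\<^sub>R d1 k) \<le> C * B"
      using \<beta>01 by (simp add: B_def mult_ac)
    have \<beta>d0: "norm ((1 - \<beta> k) *\<^sub>R d0 k) \<le> norm (d0 k)"
      using \<beta>01 by (simp add: mult_left_le_one_le)
    have dhat_le: "norm (dhat k) \<le> norm (d0 k) + C * B"
      by (rule norm_triangle_le[OF add_mono[OF \<beta>d0 \<beta>d1]])
    have dhat_B: "(norm (dhat k))\<^sup>2 \<le> C5 * (\<beta> k * w k)"
    proof -
      have "(norm (dhat k))\<^sup>2 \<le> 2 * (norm (d0 k))\<^sup>2 + 2 * (C * B)\<^sup>2"
        using norm_add_sq_le[of "(1 - \<beta> k) *\<^sub>R d0 k" "\<beta> k *\<^sub>R d1 k"]
          power_mono[OF \<beta>d0 norm_ge_zero, of 2] power_mono[OF \<beta>d1 norm_ge_zero, of 2] by linarith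
      also have "\<dots> \<le> 2 * (B / c3) + 2 * (C\<^sup>2 * (W * B))"
      proof -
        have "(norm (d0 k))\<^sup>2 \<le> B / c3"
          using B_d0 c34 by (simp add: field_simps)
        moreover have "B * B \<le> W * B"
          using B wk by (intro mult_right_mono) auto
        then have "C\<^sup>2 * (B * B) \<le> C\<^sup>2 * (W * B)"
          by (intro mult_left_mono) auto
        ultimately show ?thesis
          by (simp add: power_mult_distrib power2_eq_square[of B])
      qed
      also have "\<dots> = C5 * B" by (simp add: C5_def algebra_simps)
      finally show ?thesis by (simp add: B_def)
    qed
    \<comment> \<open>Uses \<open>B \<le> w k\<close>; the square of
      \<open>phi (x k) powr \<sigma>\<close>, a number at most \<open>1\<close>, is at most
      \<open>P\<close>.\<close>
    have dhat_P: "(norm (dhat k))\<^sup>2 \<le> C6 * (P + (norm (d0 k))\<^sup>2)"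
    proof -
      have "norm (dhat k) \<le> norm (d0 k) + C * w k"
        using dhat_le mult_left_mono[OF B(2), of C] C(1) by linarith
      also have "\<dots> \<le> (1 + C) * w k"
        using wk by (simp add: algebra_simps)
      finally have "(norm (dhat k))\<^sup>2 \<le> ((1 + C) * w k)\<^sup>2"
        by (intro power_mono) auto
      also have "\<dots> \<le> (1 + C)\<^sup>2 * (2 * (norm (d0 k))\<^sup>2 + 2 * (phi (x k) powr \<sigma>)\<^sup>2)"
      proof -
        have "(w k)\<^sup>2 \<le> 2 * (norm (d0 k))\<^sup>2 + 2 * (phi (x k) powr \<sigma>)\<^sup>2"
          using sum_squares_bound[of "norm (d0 k)" "phi (x k) powr \<sigma>"] by (simp add: power2_sum)
        then show ?thesis
          unfolding power_mult_distrib by (rule mult_left_mono) simp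
      qed
      also have "\<dots> \<le> (1 + C)\<^sup>2 * (2 * (norm (d0 k))\<^sup>2 + 2 * P)"
      proof -
        have "(phi (x k) powr \<sigma>)\<^sup>2 \<le> phi (x k) powr \<sigma>"
          using powr by (simp add: power2_eq_square mult_left_le_one_le)
        then show ?thesis
          using powr by (intro mult_left_mono add_left_mono) auto
      qed
      finally show ?thesis by (simp add: C6_def algebra_simps)
    qed
    have ball: "x k \<in> ?B" "x k + s *\<^sub>R dhat k \<in> ?B"
      if "0 \<le> s" "s \<le> 1" for s
    proof -
      have "norm (dhat k) \<le> D + C * W"
        using dhat_le D[of k] mult_left_mono[of B W C] B wk C(1) by linarith
      moreover have "norm (s *\<^sub>R dhat k) \<le> norm (dhat k)"
        using that by (simp add: mult_left_le_one_le)
      moreover have "norm (x k) \<le> R0" using R0[of k] by simp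
      moreover have "norm (x k + s *\<^sub>R dhat k) \<le> norm (x k) + norm (s *\<^sub>R dhat k)"
        by (rule norm_triangle_ineq)
      moreover have "0 \<le> D + C * W" using D0 C(1) W0 by simp
      ultimately show "x k \<in> ?B" "x k + s *\<^sub>R dhat k \<in> ?B"
        by auto
    qed
    \<comment> \<open>Row \<open>i\<close> of the second block equation; the diagonal entry carries
      the factor \<open>fbar i (x k)\<close>, and \<open>K\<close> bounds what multiplies
      it.\<close>
    have g_d1: "g i (x k) \<bullet> d1 k \<le> - w k + \<bar>fbar i (x k)\<bar> * K" for i
    proof -
      let ?q = "\<bar>fbar i (x k) + g i (x k) \<bullet> d0 k\<bar> + norm (d0 k)"
      have "transpose (Nmat (x k)) *v d1 k - Qmat (x k) (d0 k) *v h1 k = - w k *\<^sub>R (\<chi> i. 1)"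
        by (rule Gamma_solution_eqs(2)[OF \<Gamma>])
      then have "g i (x k) \<bullet> d1 k = - w k + \<bar>fbar i (x k)\<bar> * (?q * h1 k $ i)"
        unfolding transpose_Nmat_mult by (auto simp: Qmat_def diag_mat_mult vec_eq_iff mult.assoc algebra_simps)
      also have "\<dots> \<le> - w k + \<bar>fbar i (x k)\<bar> * K"
      proof (intro add_left_mono mult_left_mono)
        have "\<bar>fbar i (x k)\<bar> \<le> Mf + 1"
          using Mf[of i k] phi by (auto simp: fbar_def)
        moreover have "\<bar>g i (x k) \<bullet> d0 k\<bar> \<le> M * D"
          using Cauchy_Schwarz_ineq2[of "g i (x k)" "d0 k"]
            mult_mono[OF M(3)[OF R0[of k], of i] D[of k]] M(1) by simp
        ultimately have q: "?q \<le> Mf + 1 + M * D + D"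
          using D[of k] by linarith
        have h: "\<bar>h1 k $ i\<bar> \<le> C * W"
          using component_le_norm_cart[of "h1 k" i] d1h1(2) mult_left_mono[OF wk(2), of C] C(1) by linarith
        have "?q * h1 k $ i \<le> ?q * \<bar>h1 k $ i\<bar>"
          by (intro mult_left_mono) auto
        also have "\<dots> \<le> K"
          unfolding K_def using q h Mf0 M(1) D0 by (intro mult_mono) auto
        finally show "?q * h1 k $ i \<le> K" .
      qed simp
      finally show ?thesis .
    qed

    \<comment> \<open>Acceptance of all short steps\<close>
    have accepted: "test6 k s" if s: "0 < s" "s \<le> tb" for s
    proof -
      have s': "0 \<le> s" "s \<le> 1" using s tb(4)[of s] by auto
      let ?z = "x k + s *\<^sub>R dhat k"
      have tay: "f i ?z \<le> f i (x k) + s * (g i (x k) \<bullet> dhat k) + L * (s\<^sup>2 * (norm (dhat k))\<^sup>2)" for i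
        using L(2)[rule_format, OF ball[OF s'], THEN conjunct1, rule_format, of i] by (simp add: power_mult_distrib)
      have tayF: "F (c k) ?z \<le> F (c k) (x k) + s * (G k \<bullet> dhat k) + L * (s\<^sup>2 * (norm (dhat k))\<^sup>2)"
        using L(2)[rule_format, OF ball[OF s'], THEN conjunct2, rule_format, OF S[of k]] by (simp add: power_mult_distrib)
      have "f i ?z \<le> f i (x k) - fbar i (x k) - \<alpha>' * s * (\<beta> k * w k)" for i
        by (rule constraint_step[OF refl \<beta>01 d0_feasible g_d1 K0 tay L(1) less_imp_le[OF wk(1)] dhat_B
              s'(1) tb(1,2)]) (use s in auto)
      moreover have "0 \<le> \<alpha>' * s * (\<beta> k * w k)"
        using s' unit_params \<beta>01 wk by simp
      ultimately have "\<And>i. f i ?z \<le> max 0 (phi (x k) - \<alpha>' * s * (\<beta> k * w k))"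
        "card (Iminus (x k)) \<le> card (Iminus ?z)"
        by (rule constraints_accepted)+
      moreover have "F (c k) ?z \<le> F (c k) (x k) + \<alpha>' * s * (G k \<bullet> dhat k) + \<rho> * (1 - \<alpha>') * s * P"
        by (rule objective_step[OF slope _ theta(1) tayF L(1) dhat_P powr(4) _ s'(1) tb(3)[unfolded \<mu>_def]])
          (use descent[of k] s unit_params in auto)
      ultimately show ?thesis
        by (simp add: search_test_def P_def)
    qed
    \<comment> \<open>For \<open>j > 0\<close> the preceding trial was rejected and hence exceeds
      \<open>tb\<close>; one more factor \<open>\<eta>\<close> gives the bound.\<close>
    have "\<eta> * tb \<le> \<eta> ^ j"
    proof (cases j)
      case 0
      then show ?thesis using unit_params tb(4)[of tb] tb0 by (simp add: mult_le_one)
    next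
      case (Suc l)
      then have "\<not> \<eta> ^ l \<le> tb"
        using rejected accepted[of "\<eta> ^ l"] unit_params by auto
      then show ?thesis using Suc unit_params by simp
    qed
    then have "\<eta> * tb * (c4 * phi (x k) powr \<sigma>) \<le> \<eta> ^ j * B"
      using B_phi c34 powr unit_params by (intro mult_mono) auto
    then show "\<eta> * tb * c4 * phi (x k) powr \<sigma> \<le> \<eta> ^ j * (\<beta> k * w k)"
      by (simp add: B_def mult.assoc)
  qed
qed

section \<open>Vanishing of \<open>phi\<close> after finitely many steps\<close>

lemma phi_decreasing: "phi (x (Suc k)) \<le> phi (x k)"
proof (cases rule: step_cases[of k])
  case step4
  have "0 \<le> \<alpha> * t k * (norm (d0 k) powr \<tau> + phi (x k) powr \<sigma>)"
    using step4(2) unit_params positive_params by simp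
  then show ?thesis
    using phi_step[OF step4(1)[folded step4(3)]] phi_nonneg[of "x k"] by linarith
next
  case (step6 j)
  have "0 \<le> \<beta> k" using step6(2) by (simp add: is_arg_max_def)
  then have "0 \<le> \<alpha>' * t k * (\<beta> k * w k)"
    using step6(3) unit_params by simp
  then show ?thesis
    using phi_step[OF step6(4)[folded step6(6)]] phi_nonneg[of "x k"] by linarith
qed

text \<open>Each step lowers \<open>phi\<close> by at least
  \<open>\<kappa> * phi (x k) powr \<sigma>\<close>, truncated at \<open>0\<close>. As
  \<open>\<sigma> < 1\<close>, this amount exceeds or equals \<open>phi (x k)\<close> itself once
  \<open>phi (x k)\<close> is small.\<close>

lemma phi_vanishes_below:
  "\<exists>\<delta>>0. \<forall>k. phi (x k) \<le> \<delta> \<longrightarrow> phi (x (Suc k)) = 0"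
proof -
  obtain \<kappa>0 where \<kappa>0: "\<kappa>0 > 0" "\<forall>k j. 0 < phi (x k) \<longrightarrow> phi (x k) \<le> 1 \<longrightarrow>
    Gamma_mat (H k) (x k) (d0 k) *v stack (d1 k) (h1 k) = stack 0 (- w k *\<^sub>R (\<chi> i. 1)) \<longrightarrow>
    is_arg_max (\<lambda>b. b) (\<lambda>b. 0 \<le> b \<and> b \<le> 1 \<and>
      G k \<bullet> ((1 - b) *\<^sub>R d0 k + b *\<^sub>R d1 k) \<le> \<theta> * (G k \<bullet> d0 k) + phi (x k) powr \<theta>) (\<beta> k) \<longrightarrow>
    (\<forall>l<j. \<not> test6 k (\<eta> ^ l)) \<longrightarrow> \<kappa>0 * phi (x k) powr \<sigma> \<le> \<eta> ^ j * (\<beta> k * w k)"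
    using line_search_step_bound by blast
  define \<kappa> where "\<kappa> = min (\<alpha> * min 1 \<epsilon>) (\<alpha>' * \<kappa>0)"
  \<comment> \<open>The second entry is where \<open>\<kappa> * s powr \<sigma>\<close> equals
    \<open>s\<close>; the entry \<open>1\<close> provides \<open>phi (x k) \<le> 1\<close> for the
    Step 6 bound.\<close>
  define \<delta> where "\<delta> = min 1 (\<kappa> powr (1 / (1 - \<sigma>)))"
  have \<kappa>: "\<kappa> > 0" using \<kappa>0(1) unit_params positive_params by (simp add: \<kappa>_def)
  show ?thesis
  proof (intro exI[of _ \<delta>] conjI allI impI)
    show "\<delta> > 0" using \<kappa> by (simp add: \<delta>_def)
  next
    fix k assume small: "phi (x k) \<le> \<delta>"
    show "phi (x (Suc k)) = 0"
    proof (cases "phi (x k) = 0")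
      case True
      then show ?thesis using phi_decreasing[of k] phi_nonneg[of "x (Suc k)"] by linarith
    next
      case False
      then have pos: "0 < phi (x k)" using phi_nonneg[of "x k"] by linarith
      have le1: "phi (x k) \<le> 1" using small by (simp add: \<delta>_def)
      have \<sigma>: "0 < 1 - \<sigma>" using unit_params by simp
      have "phi (x k) powr (1 - \<sigma>) \<le> (\<kappa> powr (1 / (1 - \<sigma>))) powr (1 - \<sigma>)"
        using small pos \<sigma> by (intro powr_mono2) (auto simp: \<delta>_def)
      also have "\<dots> = \<kappa>" using \<kappa> \<sigma> by (simp add: powr_powr)
      finally have "phi (x k) powr (1 - \<sigma>) * phi (x k) powr \<sigma> \<le> \<kappa> * phi (x k) powr \<sigma>"
        by (intro mult_right_mono) auto
      then have bound: "phi (x k) \<le> \<kappa> * phi (x k) powr \<sigma>"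
        using pos by (simp flip: powr_add)
      have "phi (x (Suc k)) \<le> max 0 (phi (x k) - \<kappa> * phi (x k) powr \<sigma>)"
      proof (cases rule: step_cases[of k])
        case step4
        have "\<kappa> * phi (x k) powr \<sigma> \<le> \<alpha> * t k * (norm (d0 k) powr \<tau> + phi (x k) powr \<sigma>)"
        proof (intro mult_mono)
          have "\<alpha> * min 1 \<epsilon> \<le> \<alpha> * t k" using step4(2) unit_params by (intro mult_left_mono) auto
          then show "\<kappa> \<le> \<alpha> * t k" by (simp add: \<kappa>_def)
          show "0 \<le> \<alpha> * t k" using \<open>\<kappa> \<le> \<alpha> * t k\<close> \<kappa> by linarith
        qed auto
        then show ?thesis
          using phi_step[OF step4(1)[folded step4(3)]] by linarith
      next
        case (step6 j)
        have "\<kappa> * phi (x k) powr \<sigma> \<le> \<alpha>' * (\<kappa>0 * phi (x k) powr \<sigma>)"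
          unfolding mult.assoc[symmetric] by (intro mult_right_mono) (auto simp: \<kappa>_def)
        also have "\<dots> \<le> \<alpha>' * (\<eta> ^ j * (\<beta> k * w k))"
          using \<kappa>0(2)[rule_format, OF pos le1 step6(1,2) step6(5)[rule_format]] unit_params by (intro mult_left_mono) auto
        finally show ?thesis
          using phi_step[OF step6(4)[folded step6(6)]] step6(3) by (simp add: mult.assoc)
      qed
      with bound show ?thesis using phi_nonneg[of "x (Suc k)"] by linarith
    qed
  qed
qed

text \<open>A single iterate close to \<open>y\<close> suffices: there \<open>phi\<close> is at most
  \<open>\<delta>\<close>, and monotonicity keeps it so at all later iterates.\<close>

lemma eventually_feasible:
  assumes acc: "accumulation_point x y" and y: "y \<in> Omega_plus"
  shows "\<forall>\<^sub>F k in sequentially. phi (x (Suc k)) = 0"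
proof -
  obtain \<delta> where \<delta>: "\<delta> > 0" "\<forall>k. phi (x k) \<le> \<delta> \<longrightarrow> phi (x (Suc k)) = 0"
    using phi_vanishes_below by blast
  obtain r where lim: "(\<lambda>n. x (r n)) \<longlonglongrightarrow> y"
    using acc by (auto simp: accumulation_point_def o_def)
  have "\<forall>\<^sub>F n in sequentially. f i (x (r n)) < \<delta>" for i
  proof (rule order_tendstoD(2))
    show "(\<lambda>n. f i (x (r n))) \<longlonglongrightarrow> f i y"
      by (rule continuous_on_tendsto_compose[OF continuous_on_f[of UNIV] lim]) auto
    show "f i y < \<delta>"
      using y \<delta>(1) by (auto simp: Omega_plus_def intro: le_less_trans)
  qed
  then have "\<forall>\<^sub>F n in sequentially. \<forall>i. f i (x (r n)) < \<delta>"
    by (intro eventually_all_finite) auto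
  then obtain n where "\<forall>i. f i (x (r n)) < \<delta>"
    by (auto simp: eventually_sequentially)
  then have n: "phi (x (r n)) \<le> \<delta>"
    using \<delta>(1) by (simp add: phi_le_iff less_imp_le)
  have "phi (x (Suc k)) = 0" if "k \<ge> r n" for k
    using \<delta>(2) lift_Suc_antimono_le[of "\<lambda>k. phi (x k)", OF phi_decreasing that] n by force
  then show ?thesis
    unfolding eventually_sequentially by blast
qed

end

theorem theorem4p3:
  fixes f0 :: "real^'n \<Rightarrow> real"
    and f :: "'m::finite \<Rightarrow> real^'n \<Rightarrow> real"
    and I2 :: "'m set"
    and p \<epsilon> \<gamma> \<gamma>0 c_init \<rho> \<theta> \<sigma> \<eta> \<alpha> \<alpha>' \<tau> :: real
    and x :: "nat \<Rightarrow> real^'n"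
    and c :: "nat \<Rightarrow> real"
    and H :: "nat \<Rightarrow> real^'n^'n"
    and d0 d1 d2 d :: "nat \<Rightarrow> real^'n"
    and h1 h2 :: "nat \<Rightarrow> real^'m"
    and \<beta> t :: "nat \<Rightarrow> real"
    and xstar :: "real^'n"
    and mustar :: "real^'m"
  assumes run: "algorithm_A_run f0 f I2 p \<epsilon> \<gamma> \<gamma>0 c_init \<rho> \<theta> \<sigma> \<eta> \<alpha> \<alpha>' \<tau>
                  x c H d0 d1 d2 d h1 h2 \<beta> t"
    and smooth: "twice_cont_diff f0" "\<And>i. twice_cont_diff (f i)"
    and licq: "\<And>y. nlp.LICQ_at f I2 y"
    and bounded_iterates: "bounded (range x)"
    and bounded_H: "\<exists>a>0. \<exists>b>0. \<forall>k v. a * (norm v)\<^sup>2 \<le> v \<bullet> (H k *v v) \<and>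
                                        v \<bullet> (H k *v v) \<le> b * (norm v)\<^sup>2"
    and acc: "accumulation_point x xstar"
    and kkt: "nlp.KKT_pair f0 f I2 xstar mustar"
    and ssosc: "nlp.strong_SOSC f0 f I2 xstar mustar"
    and hess_approx:
      "(\<lambda>k. norm ((nlp.hess_Lc f0 f I2 (eventual_value c) xstar
                     (nlp.shifted_mult I2 (eventual_value c) mustar) - H k) *v d0 k))
        \<in> o(\<lambda>k. norm (d0 k))"
  shows "\<forall>\<^sub>F k in sequentially. nlp.phi f (x (Suc k)) = 0 \<and> x (Suc k) \<in> nlp.Omega_plus f"
proof -
  interpret regular_nlp f0 f I2
    by (intro regular_nlp.intro smooth licq)
  interpret regular_run f0 f I2 p \<epsilon> \<gamma> \<gamma>0 c_init \<rho> \<theta> \<sigma> \<eta> \<alpha> \<alpha>' \<tau> x c H d0 d1 d2 d h1 h2 \<beta> t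
    by (intro regular_run.intro regular_run_axioms.intro run regular_nlp_axioms bounded_iterates bounded_H)
  \<comment> \<open>The equality constraints vanish at \<open>xstar\<close>, so they satisfy the
    inequalities defining \<open>Omega_plus\<close> as well.\<close>
  have "xstar \<in> Omega_plus"
    using kkt by (fastforce simp: KKT_pair_def Omega_plus_def I1_def)
  then show ?thesis
    using eventually_feasible[OF acc] by (simp add: phi_eq_0_iff)
qed

end
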